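(* Let $R\ge 2r>0$, $d=\sqrt{R(R-2r)}$, and consider the Poristic family with circumradius $R$ and inradius $r$. For a Poristic triangle $T$ let $I_5'$ be the MacBeath inconic of the excentral triangle of $T$, with major and minor semiaxes $\mu_5'\ge\nu_5'$. Then, for every $T$ in the family, $\mu_5'=R$ and $\nu_5'=\sqrt{R^2-d^2}$, and $I_5'$ is stationary, i.e. it is one and the same ellipse for all triangles $T$ of the family; thus it is the caustic of the family of excentral triangles (the sidelines of all excentral triangles are tangent to this fixed ellipse).
   Context: Poristic family: fix in the plane a circle (the circumcircle) with center $X_3$ and radius $R$ and a circle (the incircle) with center $X_1$ and radius $r$, where $|X_1X_3|=d=\sqrt{R(R-2r)}$. The Poristic family is the one-parameter family of all triangles having these two circles as circumcircle and incircle. $X_1$ is the incenter, $X_3$ the circumcenter, and $X_{40}$ (Bevan point) is the reflection of $X_1$ about $X_3$; all three are fixed over the family. The excentral triangle of a triangle is the triangle whose vertices are its three excenters. The MacBeath inconic of an acute triangle is the ellipse inscribed in it (tangent to its three sides) with foci at its orthocenter and circumcenter, hence centered at its nine-point center. For the excentral triangle (which is always acute) the nine-point center, orthocenter and circumcenter are respectively $X_3$, $X_1$, $X_{40}$ of the original triangle. *)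

theory Defs
  imports "HOL-Analysis.Analysis"
begin

type_synonym point = "real^2"

text \<open>
  Tangency is used only for circles and ellipses of positive semiaxes (as curves, i.e. without
  their interior) and straight lines; for these, a line is tangent iff it meets the curve in
  exactly one point.
\<close>

definition tangent_at :: "point set \<Rightarrow> point set \<Rightarrow> point \<Rightarrow> bool" where
  "tangent_at S L p \<longleftrightarrow> S \<inter> L = {p}"

definition tangent :: "point set \<Rightarrow> point set \<Rightarrow> bool" where
  "tangent S L \<longleftrightarrow> (\<exists>p. tangent_at S L p)"

definition triangle :: "point \<Rightarrow> point \<Rightarrow> point \<Rightarrow> bool" where
  "triangle A B C \<longleftrightarrow> \<not> collinear {A, B, C}"

text \<open>An angle is acute iff the inner product of the vectors spanning it is positive.\<close>

definition acute_triangle :: "point \<Rightarrow> point \<Rightarrow> point \<Rightarrow> bool" where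
  "acute_triangle A B C \<longleftrightarrow> triangle A B C \<and>
     (B - A) \<bullet> (C - A) > 0 \<and> (C - B) \<bullet> (A - B) > 0 \<and> (A - C) \<bullet> (B - C) > 0"

definition is_circumcenter :: "point \<Rightarrow> point \<Rightarrow> point \<Rightarrow> point \<Rightarrow> bool" where
  "is_circumcenter Q A B C \<longleftrightarrow> dist Q A = dist Q B \<and> dist Q B = dist Q C"

definition is_orthocenter :: "point \<Rightarrow> point \<Rightarrow> point \<Rightarrow> point \<Rightarrow> bool" where
  "is_orthocenter H A B C \<longleftrightarrow>
     (H - A) \<bullet> (B - C) = 0 \<and> (H - B) \<bullet> (C - A) = 0 \<and> (H - C) \<bullet> (A - B) = 0"

text \<open>
  The curve touches the sides themselves (as closed segments), not just the sidelines; for circles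
  and ellipses this rules out curves that touch extensions of the sides from outside the triangle.
\<close>

definition tangent_to_side :: "point set \<Rightarrow> point \<Rightarrow> point \<Rightarrow> bool" where
  "tangent_to_side S A B \<longleftrightarrow> (\<exists>p \<in> closed_segment A B. tangent_at S (affine hull {A, B}) p)"

definition inscribed :: "point set \<Rightarrow> point \<Rightarrow> point \<Rightarrow> point \<Rightarrow> bool" where
  "inscribed S A B C \<longleftrightarrow> tangent_to_side S A B \<and> tangent_to_side S B C \<and> tangent_to_side S C A"

definition poristic :: "point \<Rightarrow> real \<Rightarrow> point \<Rightarrow> real \<Rightarrow> point \<Rightarrow> point \<Rightarrow> point \<Rightarrow> bool" where
  "poristic X3 R X1 r A B C \<longleftrightarrow> triangle A B C \<and>
     {A, B, C} \<subseteq> sphere X3 R \<and> inscribed (sphere X1 r) A B C"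

text \<open>
  The excircle opposite to the first vertex \<open>A\<close> touches the side \<open>BC\<close>, the side \<open>AB\<close> extended
  beyond \<open>B\<close>, and the side \<open>AC\<close> extended beyond \<open>C\<close>.
\<close>

definition is_excircle :: "point \<Rightarrow> real \<Rightarrow> point \<Rightarrow> point \<Rightarrow> point \<Rightarrow> bool" where
  "is_excircle J \<rho> A B C \<longleftrightarrow> \<rho> > 0 \<and> tangent_to_side (sphere J \<rho>) B C \<and>
     (\<exists>p. tangent_at (sphere J \<rho>) (affine hull {A, B}) p \<and> B \<in> open_segment A p) \<and>
     (\<exists>p. tangent_at (sphere J \<rho>) (affine hull {A, C}) p \<and> C \<in> open_segment A p)"

definition excenter :: "point \<Rightarrow> point \<Rightarrow> point \<Rightarrow> point" where
  "excenter A B C = (THE J. \<exists>\<rho>. is_excircle J \<rho> A B C)"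

definition ellipse_semiaxes :: "point set \<Rightarrow> real \<Rightarrow> real \<Rightarrow> bool" where
  "ellipse_semiaxes E a b \<longleftrightarrow> a \<ge> b \<and> b > 0 \<and>
     (\<exists>c u v. norm u = 1 \<and> norm v = 1 \<and> u \<bullet> v = 0 \<and>
        E = {c + x *\<^sub>R u + y *\<^sub>R v |x y. (x / a)\<^sup>2 + (y / b)\<^sup>2 = 1})"

text \<open>Coinciding foci are allowed; the ellipse is then a circle.\<close>

definition ellipse_foci :: "point set \<Rightarrow> point \<Rightarrow> point \<Rightarrow> bool" where
  "ellipse_foci E F G \<longleftrightarrow> (\<exists>a. dist F G < 2 * a \<and> E = {P. dist P F + dist P G = 2 * a})"

definition is_macbeath_inconic :: "point set \<Rightarrow> point \<Rightarrow> point \<Rightarrow> point \<Rightarrow> bool" where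
  "is_macbeath_inconic E A B C \<longleftrightarrow> acute_triangle A B C \<and>
     (\<exists>H Q. is_orthocenter H A B C \<and> is_circumcenter Q A B C \<and> ellipse_foci E H Q) \<and>
     inscribed E A B C"

end

theory Submission
  imports Defs
begin

text \<open>
  In an acute triangle with orthocenter \<open>H\<close> and circumcenter \<open>Q\<close>, the reflection of \<open>H\<close> in a side
  lies on the circumcircle; hence the minimum over that side of the sum of the distances to \<open>H\<close> and
  \<open>Q\<close> is the circumradius, and the MacBeath inconic is the ellipse with these foci whose major axis
  is the circumradius. The excentral triangle of a poristic triangle has orthocenter \<open>X1\<close>,
  circumcenter \<open>2 X3 - X1\<close> and circumradius \<open>2 R\<close>, all constant over the family. This is
  computed from the tangent lengths \<open>x, y, z\<close> of the incircle: the inner products of the vectors from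
  \<open>X1\<close> to the vertices are polynomials in \<open>x, y, z, r\<close>, and \<open>r\<^sup>2 (x + y + z) = x y z\<close>.
\<close>

subsection \<open>Plane geometry\<close>

text \<open>In the plane the orthogonal complement of \<open>w\<close> is a line: the determinant of
  \<open>g\<close> and \<open>e\<close>, multiplied by either coordinate of \<open>w\<close>,
  vanishes.\<close>

lemma orthogonal_same_imp_parallel:
  fixes g e w :: "real^2"
  assumes "g \<bullet> w = 0" "e \<bullet> w = 0" "w \<noteq> 0" "e \<noteq> 0"
  obtains l where "g = l *\<^sub>R e"
proof -
  have gw: "g$1 * w$1 + g$2 * w$2 = 0" and ew: "e$1 * w$1 + e$2 * w$2 = 0"
    using assms by (simp_all add: inner_vec_def sum_2)
  have "w$1 * (g$1 * e$2 - g$2 * e$1) = 0" "w$2 * (g$1 * e$2 - g$2 * e$1) = 0"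
    using gw ew by algebra+
  moreover have "w$1 \<noteq> 0 \<or> w$2 \<noteq> 0"
    using \<open>w \<noteq> 0\<close> by (simp add: vec_eq_iff forall_2)
  ultimately have det: "g$1 * e$2 = g$2 * e$1"
    by auto
  have "e$1 \<noteq> 0 \<or> e$2 \<noteq> 0"
    using \<open>e \<noteq> 0\<close> by (simp add: vec_eq_iff forall_2)
  then show thesis
  proof
    assume "e$1 \<noteq> 0"
    then have "g = (g$1 / e$1) *\<^sub>R e"
      using det by (simp add: vec_eq_iff forall_2 field_simps)
    then show thesis by (rule that)
  next
    assume "e$2 \<noteq> 0"
    then have "g = (g$2 / e$2) *\<^sub>R e"
      using det by (simp add: vec_eq_iff forall_2 field_simps)
    then show thesis by (rule that)
  qed
qed

lemma triangle_distinct: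
  assumes "triangle A B C"
  shows "A \<noteq> B" "B \<noteq> C" "C \<noteq> A"
  using assms unfolding triangle_def by (auto simp: insert_commute)

lemma triangle_rotate: "triangle A B C \<Longrightarrow> triangle B C A"
  unfolding triangle_def by (simp add: insert_commute)

text \<open>Two edge vectors span the plane. Most identifications of points below reduce to this:
  the difference of the two candidates is orthogonal to two edges.\<close>

lemma triangle_orthogonal_imp_zero:
  assumes tri: "triangle A B C" and "w \<bullet> (B - A) = 0" "w \<bullet> (C - A) = 0"
  shows "w = 0"
proof (rule ccontr)
  assume "w \<noteq> 0"
  moreover have "B - A \<noteq> 0" using triangle_distinct[OF tri] by simp
  ultimately obtain l where l: "C - A = l *\<^sub>R (B - A)"
    using assms(2,3) by (metis orthogonal_same_imp_parallel inner_commute)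
  have "collinear {0, B - A, C - A}"
    unfolding collinear_lemma using l by blast
  then have "collinear {B, A, C}"
    using collinear_3[of B A C] by (simp add: insert_commute)
  then show False using tri unfolding triangle_def by (simp add: insert_commute)
qed

text \<open>Noncollinearity comes for free: for \<open>C = A + t *\<^sub>R (B - A)\<close> the three
  products are \<open>t * D\<close>, \<open>(1 - t) * D\<close> and
  \<open>- (t * (1 - t) * D)\<close>, which cannot all be positive.\<close>

lemma acute_triangleI:
  assumes "(B - A) \<bullet> (C - A) > 0" "(C - B) \<bullet> (A - B) > 0" "(A - C) \<bullet> (B - C) > 0"
  shows "acute_triangle A B C"
proof -
  have "\<not> collinear {A, B, C}"
  proof
    assume "collinear {A, B, C}"
    then have "collinear {B, A, C}" by (simp add: insert_commute)
    then have "collinear {0, B - A, C - A}"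
      by (simp add: collinear_3)
    then obtain t where t: "C - A = t *\<^sub>R (B - A)"
      unfolding collinear_lemma using assms(1) by (metis inner_zero_left inner_zero_right less_irrefl)
    have C: "C = A + t *\<^sub>R (B - A)" using t by (simp add: algebra_simps)
    define D where "D = (B - A) \<bullet> (B - A)"
    have "D \<ge> 0" unfolding D_def by simp
    have "t * D > 0"
      using assms(1) unfolding C D_def by simp
    moreover have "(C - B) \<bullet> (A - B) = (1 - t) * D"
      unfolding C D_def by (simp add: inner_simps algebra_simps)
    moreover have "(A - C) \<bullet> (B - C) = - (t * (1 - t) * D)"
      unfolding C D_def by (simp add: inner_simps algebra_simps)
    ultimately have "t > 0" "1 - t > 0" "t * (1 - t) * D < 0"
      using assms(2,3) \<open>D \<ge> 0\<close> by (auto simp: zero_less_mult_iff)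
    then show False using \<open>D \<ge> 0\<close> by (simp add: mult_less_0_iff)
  qed
  then show ?thesis using assms unfolding acute_triangle_def triangle_def by blast
qed

lemma is_orthocenter_unique:
  assumes tri: "triangle A B C" and "is_orthocenter H A B C" "is_orthocenter K A B C"
  shows "H = K"
proof -
  have "(H - K) \<bullet> (C - B) = 0" "(H - K) \<bullet> (A - B) = 0"
    using assms(2,3) unfolding is_orthocenter_def by (simp_all add: inner_simps)
  then show ?thesis
    using triangle_orthogonal_imp_zero[OF triangle_rotate[OF tri]] by fastforce
qed

lemma inner_add_scaleR_self:
  fixes u v :: "'a::real_inner"
  shows "(u + k *\<^sub>R v) \<bullet> (u + k *\<^sub>R v) = u \<bullet> u + 2 * k * (u \<bullet> v) + k\<^sup>2 * (v \<bullet> v)"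
  by (simp add: inner_simps inner_commute power2_eq_square)

text \<open>The quadratic term in \<open>Q\<close> cancels, so equidistance is a linear condition on
  \<open>Q\<close>.\<close>

lemma dist_eq_iff_inner:
  fixes Q A B :: "'a::real_inner"
  shows "dist Q A = dist Q B \<longleftrightarrow> 2 * (Q \<bullet> (B - A)) = B \<bullet> B - A \<bullet> A"
proof -
  have "dist Q A = dist Q B \<longleftrightarrow> (Q - A) \<bullet> (Q - A) = (Q - B) \<bullet> (Q - B)"
    unfolding dist_norm norm_eq ..
  also have "\<dots> \<longleftrightarrow> 2 * (Q \<bullet> (B - A)) = B \<bullet> B - A \<bullet> A"
    by (auto simp: inner_simps inner_commute)
  finally show ?thesis .
qed

lemma is_circumcenter_unique:
  assumes tri: "triangle A B C" and "is_circumcenter P A B C" "is_circumcenter Q A B C"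
  shows "P = Q"
proof -
  have "dist P A = dist P B" "dist P A = dist P C" "dist Q A = dist Q B" "dist Q A = dist Q C"
    using assms(2,3) unfolding is_circumcenter_def by simp_all
  then have "(P - Q) \<bullet> (B - A) = 0" "(P - Q) \<bullet> (C - A) = 0"
    unfolding dist_eq_iff_inner by (simp_all add: inner_diff_left[of P Q])
  then show ?thesis
    using triangle_orthogonal_imp_zero[OF tri] by fastforce
qed

subsection \<open>Tangents to circles\<close>

text \<open>Having a single common point forces the radius to \<open>p\<close> to be perpendicular
  to the line; both equations are then Pythagoras.\<close>

lemma tangent_at_sphere_dist:
  assumes tan: "tangent_at (sphere J \<rho>) (affine hull {P, Q}) p" and "P \<noteq> Q"
  shows "(dist J P)\<^sup>2 = \<rho>\<^sup>2 + (dist P p)\<^sup>2" "(dist J Q)\<^sup>2 = \<rho>\<^sup>2 + (dist Q p)\<^sup>2"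
proof -
  have inter: "sphere J \<rho> \<inter> range (\<lambda>u. P + u *\<^sub>R (Q - P)) = {p}"
    using tan unfolding tangent_at_def affine_hull_2_alt .
  then have "p \<in> range (\<lambda>u. P + u *\<^sub>R (Q - P))" and \<rho>: "dist J p = \<rho>" by auto
  then obtain u where p: "p = P + u *\<^sub>R (Q - P)" by blast
  define D where "D = (Q - P) \<bullet> (Q - P)"
  have "D \<noteq> 0" using \<open>P \<noteq> Q\<close> unfolding D_def by simp
  define t where "t = (J - p) \<bullet> (Q - P) / D"
  have tD: "(J - p) \<bullet> (Q - P) = t * D" unfolding t_def using \<open>D \<noteq> 0\<close> by simp
  \<comment> \<open>The second intersection of the line with the circle is the mirror image of \<open>p\<close> in the
    foot of the perpendicular from \<open>J\<close>.\<close>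
  define q where "q = p + (2 * t) *\<^sub>R (Q - P)"
  have "(J - q) \<bullet> (J - q) = (J - p) \<bullet> (J - p) - 4 * t * ((J - p) \<bullet> (Q - P)) + 4 * t * t * D"
    unfolding q_def D_def by (simp add: inner_simps inner_commute algebra_simps)
  also have "\<dots> = (J - p) \<bullet> (J - p)" unfolding tD by simp
  finally have "dist J q = \<rho>" using \<rho> unfolding dist_norm norm_eq_sqrt_inner by simp
  moreover have "q \<in> range (\<lambda>u. P + u *\<^sub>R (Q - P))"
    unfolding q_def p by (intro range_eqI[of _ _ "u + 2 * t"]) (simp add: algebra_simps)
  ultimately have "q \<in> sphere J \<rho> \<inter> range (\<lambda>u. P + u *\<^sub>R (Q - P))" by simp
  then have "q = p" unfolding inter by simp
  then have "t = 0" unfolding q_def using \<open>P \<noteq> Q\<close> by simp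
  then have orth: "(J - p) \<bullet> (Q - P) = 0" using tD by simp
  have rho2: "\<rho>\<^sup>2 = (J - p) \<bullet> (J - p)"
    using \<rho> unfolding dist_norm by (simp flip: power2_norm_eq_inner)
  have pyth: "(dist J (p + v *\<^sub>R (Q - P)))\<^sup>2 = \<rho>\<^sup>2 + (dist (p + v *\<^sub>R (Q - P)) p)\<^sup>2" for v
  proof -
    have "(dist J (p + v *\<^sub>R (Q - P)))\<^sup>2
        = (J - p) \<bullet> (J - p) - 2 * v * ((J - p) \<bullet> (Q - P)) + v * v * D"
      unfolding dist_norm power2_norm_eq_inner D_def
      by (simp add: inner_simps inner_commute algebra_simps)
    moreover have "(dist (p + v *\<^sub>R (Q - P)) p)\<^sup>2 = v * v * D"
      unfolding dist_norm power2_norm_eq_inner D_def by simp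
    ultimately show ?thesis using orth rho2 by simp
  qed
  have P: "p + (- u) *\<^sub>R (Q - P) = P" and Q: "p + (1 - u) *\<^sub>R (Q - P) = Q"
    unfolding p by (simp_all add: algebra_simps)
  show "(dist J P)\<^sup>2 = \<rho>\<^sup>2 + (dist P p)\<^sup>2" "(dist J Q)\<^sup>2 = \<rho>\<^sup>2 + (dist Q p)\<^sup>2"
    using pyth[of "- u"] pyth[of "1 - u"] unfolding P Q .
qed

text \<open>Subtracting the two hypotheses fixes the foot of the perpendicular from \<open>J\<close>
  at parameter \<open>t\<close>; elsewhere on the line the squared distance exceeds that at the foot
  by \<open>(t - u)\<^sup>2 * D\<close>. As \<open>t\<close> ranges over all reals, touching points
  outside the segment are covered, as excircles require.\<close>

lemma tangent_at_sphereI: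
  assumes "\<rho> \<ge> 0"
    and P: "(dist J P)\<^sup>2 = \<rho>\<^sup>2 + (t * dist P Q)\<^sup>2"
    and Q: "(dist J Q)\<^sup>2 = \<rho>\<^sup>2 + ((1 - t) * dist P Q)\<^sup>2"
  shows "tangent_at (sphere J \<rho>) (affine hull {P, Q}) (P + t *\<^sub>R (Q - P))"
proof -
  define D where "D = (Q - P) \<bullet> (Q - P)"
  have dPQ: "(dist P Q)\<^sup>2 = D"
    unfolding D_def dist_norm power2_norm_eq_inner by (simp add: inner_simps inner_commute)
  have JP: "(J - P) \<bullet> (J - P) = \<rho>\<^sup>2 + t\<^sup>2 * D"
    using P unfolding dist_norm[of J] power2_norm_eq_inner by (simp add: power_mult_distrib dPQ)
  have JQ: "(J - Q) \<bullet> (J - Q) = \<rho>\<^sup>2 + (1 - t)\<^sup>2 * D"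
    using Q unfolding dist_norm[of J] power2_norm_eq_inner by (simp add: power_mult_distrib dPQ)
  have "(J - Q) \<bullet> (J - Q) = (J - P) \<bullet> (J - P) - 2 * ((J - P) \<bullet> (Q - P)) + D"
    unfolding D_def by (simp add: inner_simps inner_commute)
  then have JPQ: "(J - P) \<bullet> (Q - P) = t * D"
    unfolding JP JQ by (simp add: power2_eq_square algebra_simps)
  have dist: "(dist J (P + u *\<^sub>R (Q - P)))\<^sup>2 = \<rho>\<^sup>2 + (t - u)\<^sup>2 * D" for u
  proof -
    have "(dist J (P + u *\<^sub>R (Q - P)))\<^sup>2
        = (J - P) \<bullet> (J - P) - 2 * u * ((J - P) \<bullet> (Q - P)) + u * u * D"
      unfolding dist_norm power2_norm_eq_inner D_def
      by (simp add: inner_simps inner_commute algebra_simps)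
    then show ?thesis unfolding JP JPQ by (simp add: power2_eq_square algebra_simps)
  qed
  have iff: "dist J (P + u *\<^sub>R (Q - P)) = \<rho> \<longleftrightarrow> P + u *\<^sub>R (Q - P) = P + t *\<^sub>R (Q - P)" for u
  proof -
    have "dist J (P + u *\<^sub>R (Q - P)) = \<rho> \<longleftrightarrow> (dist J (P + u *\<^sub>R (Q - P)))\<^sup>2 = \<rho>\<^sup>2"
      using \<open>\<rho> \<ge> 0\<close> by simp
    \<comment> \<open>\<open>D = 0\<close> is the degenerate case \<open>P = Q\<close>, where all
      the points \<open>P + u *\<^sub>R (Q - P)\<close> coincide.\<close>
    also have "\<dots> \<longleftrightarrow> t = u \<or> D = 0" unfolding dist by simp
    also have "\<dots> \<longleftrightarrow> P + u *\<^sub>R (Q - P) = P + t *\<^sub>R (Q - P)"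
      unfolding D_def by auto
    finally show ?thesis .
  qed
  then show ?thesis
    unfolding tangent_at_def affine_hull_2_alt by auto
qed

text \<open>\<open>m\<close> and \<open>n\<close> are the tangent lengths from \<open>P\<close> and
  \<open>Q\<close>; they add up to the side because the touching point lies between the
  endpoints.\<close>

lemma tangent_to_side_sphereD:
  assumes "tangent_to_side (sphere J \<rho>) P Q" "P \<noteq> Q"
  obtains m n where "m \<ge> 0" "n \<ge> 0" "dist P Q = m + n"
    "(dist J P)\<^sup>2 = \<rho>\<^sup>2 + m\<^sup>2" "(dist J Q)\<^sup>2 = \<rho>\<^sup>2 + n\<^sup>2"
proof -
  obtain p where "p \<in> closed_segment P Q" "tangent_at (sphere J \<rho>) (affine hull {P, Q}) p"
    using assms(1) unfolding tangent_to_side_def by blast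
  then show thesis
    using that[of "dist P p" "dist Q p"] tangent_at_sphere_dist[OF _ \<open>P \<noteq> Q\<close>]
    by (simp add: between dist_commute flip: between_mem_segment)
qed

lemma tangent_beyond_sphereD:
  assumes "tangent_at (sphere J \<rho>) (affine hull {P, Q}) p" "Q \<in> open_segment P p"
  obtains n where "n \<ge> 0"
    "(dist J P)\<^sup>2 = \<rho>\<^sup>2 + (dist P Q + n)\<^sup>2" "(dist J Q)\<^sup>2 = \<rho>\<^sup>2 + n\<^sup>2"
proof -
  have "P \<noteq> Q" using assms(2) by (auto simp: open_segment_def)
  have "Q \<in> closed_segment P p" using assms(2) by (simp add: open_segment_def)
  then have "dist P p = dist P Q + dist Q p"
    by (simp add: between flip: between_mem_segment)
  then show thesis
    using that[of "dist Q p"] tangent_at_sphere_dist[OF assms(1) \<open>P \<noteq> Q\<close>] by simp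
qed

subsection \<open>Tangent lengths of the incircle\<close>

text \<open>The metric data of a triangle with its incircle. Since \<open>x + y + z\<close> is the
  semiperimeter, the last equation is Heron's formula combined with area = inradius times
  semiperimeter; \<open>incenter_weights\<close> derives it from the distances.\<close>

definition tangent_lengths ::
    "point \<Rightarrow> real \<Rightarrow> point \<Rightarrow> point \<Rightarrow> point \<Rightarrow> real \<Rightarrow> real \<Rightarrow> real \<Rightarrow> bool" where
  "tangent_lengths I r A B C x y z \<longleftrightarrow> triangle A B C \<and> r > 0 \<and> x > 0 \<and> y > 0 \<and> z > 0 \<and>
     dist A B = x + y \<and> dist B C = y + z \<and> dist C A = z + x \<and>
     (dist I A)\<^sup>2 = r\<^sup>2 + x\<^sup>2 \<and> (dist I B)\<^sup>2 = r\<^sup>2 + y\<^sup>2 \<and> (dist I C)\<^sup>2 = r\<^sup>2 + z\<^sup>2 \<and>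
     r\<^sup>2 * (x + y + z) = x * y * z"

lemma tangent_lengths_rotate:
  "tangent_lengths I r A B C x y z \<Longrightarrow> tangent_lengths I r B C A y z x"
  unfolding tangent_lengths_def using triangle_rotate by (auto simp: algebra_simps)

text \<open>The law of cosines; it turns distance data into inner products.\<close>

lemma inner_eq_dist:
  fixes I A B :: "'a::real_inner"
  shows "(A - I) \<bullet> (B - I) = ((dist I A)\<^sup>2 + (dist I B)\<^sup>2 - (dist A B)\<^sup>2) / 2"
  unfolding dist_norm power2_norm_eq_inner by (simp add: inner_simps inner_commute)

lemma tangent_lengths_inner:
  assumes "tangent_lengths I r A B C x y z"
  shows "(A - I) \<bullet> (A - I) = r\<^sup>2 + x\<^sup>2" "(B - I) \<bullet> (B - I) = r\<^sup>2 + y\<^sup>2"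
    "(C - I) \<bullet> (C - I) = r\<^sup>2 + z\<^sup>2" "(A - I) \<bullet> (B - I) = r\<^sup>2 - x * y"
    "(B - I) \<bullet> (C - I) = r\<^sup>2 - y * z" "(A - I) \<bullet> (C - I) = r\<^sup>2 - x * z"
  using assms unfolding tangent_lengths_def inner_eq_dist
  by (auto simp: power2_eq_square field_simps dist_commute[of A C])

text \<open>The weights are the side lengths, the barycentric coordinates of the incenter. The
  products of \<open>?w\<close> with the three vectors from \<open>I\<close> agree, so
  \<open>?w\<close> is orthogonal to the edges and vanishes; their common value
  \<open>2 * (r\<^sup>2 * (x + y + z) - x * y * z)\<close> is then zero too.\<close>

lemma incenter_weights:
  assumes tri: "triangle A B C"
    and AB: "dist A B = x + y" and BC: "dist B C = y + z" and CA: "dist C A = z + x"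
    and IA: "(dist I A)\<^sup>2 = r\<^sup>2 + x\<^sup>2" and IB: "(dist I B)\<^sup>2 = r\<^sup>2 + y\<^sup>2"
    and IC: "(dist I C)\<^sup>2 = r\<^sup>2 + z\<^sup>2"
  shows "(y + z) *\<^sub>R (A - I) + (z + x) *\<^sub>R (B - I) + (x + y) *\<^sub>R (C - I) = 0" (is "?w = 0")
    and "r\<^sup>2 * (x + y + z) = x * y * z"
proof -
  have AC: "dist A C = z + x" using CA by (simp add: dist_commute)
  have g: "(A - I) \<bullet> (A - I) = r\<^sup>2 + x\<^sup>2" "(B - I) \<bullet> (B - I) = r\<^sup>2 + y\<^sup>2"
    "(C - I) \<bullet> (C - I) = r\<^sup>2 + z\<^sup>2" "(A - I) \<bullet> (B - I) = r\<^sup>2 - x * y"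
    "(B - I) \<bullet> (C - I) = r\<^sup>2 - y * z" "(A - I) \<bullet> (C - I) = r\<^sup>2 - x * z"
    unfolding inner_eq_dist AB BC AC IA IB IC by (auto simp: power2_eq_square field_simps)
  have g': "(B - I) \<bullet> (A - I) = r\<^sup>2 - x * y"
    "(C - I) \<bullet> (B - I) = r\<^sup>2 - y * z" "(C - I) \<bullet> (A - I) = r\<^sup>2 - x * z"
    using g by (simp_all add: inner_commute)
  have wA: "?w \<bullet> (A - I) = (y + z) * (r\<^sup>2 + x\<^sup>2) + (z + x) * (r\<^sup>2 - x * y) + (x + y) * (r\<^sup>2 - x * z)"
    by (simp only: inner_add_left inner_scaleR_left g g')
  have wB: "?w \<bullet> (B - I) = (y + z) * (r\<^sup>2 - x * y) + (z + x) * (r\<^sup>2 + y\<^sup>2) + (x + y) * (r\<^sup>2 - y * z)"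
    by (simp only: inner_add_left inner_scaleR_left g g')
  have wC: "?w \<bullet> (C - I) = (y + z) * (r\<^sup>2 - x * z) + (z + x) * (r\<^sup>2 - y * z) + (x + y) * (r\<^sup>2 + z\<^sup>2)"
    by (simp only: inner_add_left inner_scaleR_left g g')
  have "?w \<bullet> (B - A) = ?w \<bullet> (B - I) - ?w \<bullet> (A - I)" "?w \<bullet> (C - A) = ?w \<bullet> (C - I) - ?w \<bullet> (A - I)"
    by (simp_all add: inner_diff_right)
  then have "?w \<bullet> (B - A) = 0" "?w \<bullet> (C - A) = 0"
    unfolding wA wB wC by (simp_all add: power2_eq_square algebra_simps)
  then show w: "?w = 0" by (rule triangle_orthogonal_imp_zero[OF tri])
  show "r\<^sup>2 * (x + y + z) = x * y * z"
    using wA unfolding w by (simp add: power2_eq_square algebra_simps)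
qed

lemma inscribed_sphere_tangent_lengths:
  assumes tri: "triangle A B C" and ins: "inscribed (sphere I r) A B C" and "r > 0"
  obtains x y z where "tangent_lengths I r A B C x y z"
proof -
  note ne = triangle_distinct[OF tri]
  obtain x y where x: "x \<ge> 0" "y \<ge> 0" "dist A B = x + y"
    "(dist I A)\<^sup>2 = r\<^sup>2 + x\<^sup>2" "(dist I B)\<^sup>2 = r\<^sup>2 + y\<^sup>2"
    using ins ne unfolding inscribed_def by (metis tangent_to_side_sphereD)
  obtain y' z where y: "y' \<ge> 0" "z \<ge> 0" "dist B C = y' + z"
    "(dist I B)\<^sup>2 = r\<^sup>2 + y'\<^sup>2" "(dist I C)\<^sup>2 = r\<^sup>2 + z\<^sup>2"
    using ins ne unfolding inscribed_def by (metis tangent_to_side_sphereD)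
  obtain z' x' where z: "z' \<ge> 0" "x' \<ge> 0" "dist C A = z' + x'"
    "(dist I C)\<^sup>2 = r\<^sup>2 + z'\<^sup>2" "(dist I A)\<^sup>2 = r\<^sup>2 + x'\<^sup>2"
    using ins ne unfolding inscribed_def by (metis tangent_to_side_sphereD)
  \<comment> \<open>The two tangents from a vertex are equally long, having the same square.\<close>
  have "x' = x" "y' = y" "z' = z"
    using x y z by (simp_all add: power2_eq_iff_nonneg)
  then have bc: "dist B C = y + z" and ca: "dist C A = z + x" using y z by simp_all
  have rel: "r\<^sup>2 * (x + y + z) = x * y * z"
    by (rule incenter_weights(2)[OF tri x(3) bc ca x(4,5) y(5)])
  have "x + y > 0" using x(3) ne(1) by (metis zero_less_dist_iff)
  \<comment> \<open>A zero tangent length would annihilate the right side of \<open>rel\<close>,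
    while the left side is positive.\<close>
  then have "x * y * z > 0" unfolding rel[symmetric] using \<open>r > 0\<close> y(2) by simp
  then have "x > 0" "y > 0" "z > 0" using x(1,2) y(2) by (auto simp: less_le)
  then show thesis
    using that[of x y z] x(3-5) y(5) bc ca rel tri \<open>r > 0\<close> unfolding tangent_lengths_def by blast
qed

text \<open>Equality of tangents from each vertex makes the tangent length from \<open>A\<close> the
  semiperimeter, against \<open>x\<close> for the incircle. Hence the excenter is the image of
  \<open>I\<close> under the homothety at \<open>A\<close> with ratio
  \<open>(x + y + z) / x\<close>.\<close>

lemma is_excircle_center:
  assumes tl: "tangent_lengths I r A B C x y z" and exc: "is_excircle J \<rho> A B C"
  shows "J = A + ((x + y + z) / x) *\<^sub>R (I - A)"
proof -
  have tri: "triangle A B C" and pos: "x > 0" "y > 0" "z > 0"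
    and AB: "dist A B = x + y" and BC: "dist B C = y + z" and CA: "dist A C = z + x"
    using tl unfolding tangent_lengths_def by (simp_all add: dist_commute)
  obtain m n where mn: "m \<ge> 0" "n \<ge> 0" "y + z = m + n"
    "(dist J B)\<^sup>2 = \<rho>\<^sup>2 + m\<^sup>2" "(dist J C)\<^sup>2 = \<rho>\<^sup>2 + n\<^sup>2"
    using exc triangle_distinct[OF tri] unfolding is_excircle_def BC[symmetric]
    by (metis tangent_to_side_sphereD)
  obtain m' where m': "m' \<ge> 0" "(dist J A)\<^sup>2 = \<rho>\<^sup>2 + (x + y + m')\<^sup>2" "(dist J B)\<^sup>2 = \<rho>\<^sup>2 + m'\<^sup>2"
    using exc unfolding is_excircle_def AB[symmetric] by (metis tangent_beyond_sphereD)
  obtain n' where n': "n' \<ge> 0" "(dist J A)\<^sup>2 = \<rho>\<^sup>2 + (z + x + n')\<^sup>2" "(dist J C)\<^sup>2 = \<rho>\<^sup>2 + n'\<^sup>2"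
    using exc unfolding is_excircle_def CA[symmetric] by (metis tangent_beyond_sphereD)
  have eqs: "m' = m" "n' = n" "x + y + m' = z + x + n'"
    using mn m' n' pos by (simp_all add: power2_eq_iff_nonneg)
  \<comment> \<open>\<open>eqs\<close> gives the difference of \<open>m\<close> and
    \<open>n\<close>, \<open>mn(3)\<close> their sum.\<close>
  then have mz: "m = z" and ny: "n = y" using mn(3) by linarith+
  have JA: "(dist A J)\<^sup>2 = \<rho>\<^sup>2 + (x + y + z)\<^sup>2" and JB: "(dist J B)\<^sup>2 = \<rho>\<^sup>2 + z\<^sup>2"
    and JC: "(dist J C)\<^sup>2 = \<rho>\<^sup>2 + y\<^sup>2"
    using mn m' eqs mz ny by (simp_all add: dist_commute)
  have IA: "(dist A I)\<^sup>2 = r\<^sup>2 + x\<^sup>2" and IB: "(dist I B)\<^sup>2 = r\<^sup>2 + y\<^sup>2"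
    and IC: "(dist I C)\<^sup>2 = r\<^sup>2 + z\<^sup>2"
    using tl unfolding tangent_lengths_def by (simp_all add: dist_commute)
  \<comment> \<open>The unknown radius cancels in the law of cosines, so these products depend on
    the tangent lengths alone.\<close>
  have J: "(J - A) \<bullet> (B - A) = (x + y + z) * (x + y)" "(J - A) \<bullet> (C - A) = (x + y + z) * (z + x)"
    unfolding inner_eq_dist JA JB JC AB CA by (simp_all add: power2_eq_square algebra_simps)
  have I: "(I - A) \<bullet> (B - A) = x * (x + y)" "(I - A) \<bullet> (C - A) = x * (z + x)"
    unfolding inner_eq_dist IA IB IC AB CA by (simp_all add: power2_eq_square algebra_simps)
  have "(J - A - ((x + y + z) / x) *\<^sub>R (I - A)) = 0"
    by (rule triangle_orthogonal_imp_zero[OF tri])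
      (use pos in \<open>simp_all add: inner_diff_left[of "J - A"] inner_scaleR_left J I\<close>)
  then show ?thesis by (simp add: algebra_simps)
qed

text \<open>Existence of the excircle: together with uniqueness of its center this justifies the
  definite description in \<open>excenter\<close>.\<close>

lemma is_excircleI:
  assumes tl: "tangent_lengths I r A B C x y z"
  shows "is_excircle (A + ((x + y + z) / x) *\<^sub>R (I - A)) ((x + y + z) * r / x) A B C"
    (is "is_excircle ?J ?\<rho> A B C")
proof -
  have tri: "triangle A B C" and pos: "r > 0" "x > 0" "y > 0" "z > 0"
    and AB: "dist A B = x + y" and BC: "dist B C = y + z" and CA: "dist A C = z + x"
    using tl unfolding tangent_lengths_def by (simp_all add: dist_commute)
  have "?\<rho> > 0" using pos by simp
  note g = tangent_lengths_inner[OF tl]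
  \<comment> \<open>The homothety ratio at \<open>A\<close> is \<open>1 + k\<close>, so seen from
    \<open>I\<close> the excenter is \<open>- k\<close> times the vector to \<open>A\<close>. This
    turns the squared distances below into perfect squares plus the squared radius.\<close>
  define k where "k = (y + z) / x"
  have kx: "k * x = y + z" unfolding k_def using pos by simp
  have s: "(x + y + z) / x = 1 + k" unfolding k_def using pos by (simp add: field_simps)
  have rho: "?\<rho> = (1 + k) * r" unfolding s[symmetric] by simp
  have J: "?J - P = - k *\<^sub>R (A - I) - (P - I)" for P
    unfolding s by (simp add: algebra_simps)
  have JP: "(dist ?J P)\<^sup>2 = k\<^sup>2 * ((A - I) \<bullet> (A - I)) + 2 * k * ((A - I) \<bullet> (P - I)) + (P - I) \<bullet> (P - I)" for P
    unfolding dist_norm J power2_norm_eq_inner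
    by (simp add: inner_simps inner_commute power2_eq_square algebra_simps)
  have "(dist ?J A)\<^sup>2 = ?\<rho>\<^sup>2 + (x + k * x)\<^sup>2"
    unfolding JP g rho by (simp add: power2_eq_square algebra_simps)
  then have JA: "(dist ?J A)\<^sup>2 = ?\<rho>\<^sup>2 + (x + y + z)\<^sup>2" unfolding kx by (simp add: algebra_simps)
  have "(dist ?J B)\<^sup>2 = ?\<rho>\<^sup>2 + (k * x - y)\<^sup>2"
    unfolding JP g rho by (simp add: power2_eq_square algebra_simps)
  then have JB: "(dist ?J B)\<^sup>2 = ?\<rho>\<^sup>2 + z\<^sup>2" unfolding kx by simp
  have "(dist ?J C)\<^sup>2 = ?\<rho>\<^sup>2 + (k * x - z)\<^sup>2"
    unfolding JP g rho by (simp add: power2_eq_square algebra_simps)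
  then have JC: "(dist ?J C)\<^sup>2 = ?\<rho>\<^sup>2 + y\<^sup>2" unfolding kx by simp
  \<comment> \<open>\<open>w\<close> is the tangent length from \<open>Q\<close> to the excircle:
    \<open>z\<close> for \<open>Q = B\<close> and \<open>y\<close> for \<open>Q = C\<close>. The
    touching point has parameter \<open>t > 1\<close>, beyond \<open>Q\<close>.\<close>
  have beyond: "\<exists>p. tangent_at (sphere ?J ?\<rho>) (affine hull {A, Q}) p \<and> Q \<in> open_segment A p"
    if "A \<noteq> Q" and AQ: "dist A Q = x + y + z - w" and "w > 0" "x + y + z - w > 0"
      and JQ: "(dist ?J Q)\<^sup>2 = ?\<rho>\<^sup>2 + w\<^sup>2" for Q w
  proof -
    define t where "t = (x + y + z) / (x + y + z - w)"
    have "t > 1" unfolding t_def using that by simp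
    have t: "t * dist A Q = x + y + z" "(1 - t) * dist A Q = - w"
      unfolding AQ t_def using that by (simp_all add: field_simps)
    have "tangent_at (sphere ?J ?\<rho>) (affine hull {A, Q}) (A + t *\<^sub>R (Q - A))"
      by (rule tangent_at_sphereI) (use \<open>?\<rho> > 0\<close> in \<open>simp_all only: t JA JQ power2_minus less_imp_le\<close>)
    moreover have "Q \<in> open_segment A (A + t *\<^sub>R (Q - A))"
      unfolding in_segment using \<open>t > 1\<close> \<open>A \<noteq> Q\<close>
      by (auto intro!: exI[of _ "1 / t"] simp: algebra_simps)
    ultimately show ?thesis by blast
  qed
  have "tangent_to_side (sphere ?J ?\<rho>) B C"
  proof -
    \<comment> \<open>The excircle touches \<open>BC\<close> at distance \<open>z\<close> from
      \<open>B\<close>, where the incircle has distance \<open>y\<close>.\<close>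
    define t where "t = z / (y + z)"
    have "0 \<le> t" "t \<le> 1" unfolding t_def using pos by simp_all
    have t: "t * dist B C = z" "(1 - t) * dist B C = y"
      unfolding BC t_def using pos by (simp_all add: field_simps)
    have "tangent_at (sphere ?J ?\<rho>) (affine hull {B, C}) (B + t *\<^sub>R (C - B))"
      by (rule tangent_at_sphereI) (use \<open>?\<rho> > 0\<close> in \<open>simp_all only: t JB JC less_imp_le\<close>)
    moreover have "B + t *\<^sub>R (C - B) \<in> closed_segment B C"
      unfolding in_segment using \<open>0 \<le> t\<close> \<open>t \<le> 1\<close> by (auto intro!: exI[of _ t] simp: algebra_simps)
    ultimately show ?thesis unfolding tangent_to_side_def by blast
  qed
  moreover note beyond[of B z] beyond[of C y]
  ultimately show ?thesis
    unfolding is_excircle_def using \<open>?\<rho> > 0\<close> pos AB CA JB JC triangle_distinct[OF tri] by auto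
qed

lemma excenter_eq:
  assumes "tangent_lengths I r A B C x y z"
  shows "excenter A B C = A + ((x + y + z) / x) *\<^sub>R (I - A)"
  unfolding excenter_def
  by (rule the_equality) (use assms is_excircleI is_excircle_center in blast)+

subsection \<open>The MacBeath inconic of an acute triangle\<close>

lemma acute_triangle_rotate: "acute_triangle A B C \<Longrightarrow> acute_triangle B C A"
  unfolding acute_triangle_def using triangle_rotate by auto

lemma is_orthocenter_rotate: "is_orthocenter H A B C \<Longrightarrow> is_orthocenter H B C A"
  unfolding is_orthocenter_def by simp

lemma is_circumcenter_rotate: "is_circumcenter Q A B C \<Longrightarrow> is_circumcenter Q B C A"
  unfolding is_circumcenter_def by simp

text \<open>Being an orthocenter means that the three products agree; acuteness determines the sign
  of their common value.\<close>

lemma acute_orthocenter_inner: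
  assumes acute: "acute_triangle A B C" and ort: "is_orthocenter H A B C"
  obtains K where "K > 0" "(A - H) \<bullet> (B - H) = - K" "(B - H) \<bullet> (C - H) = - K"
    "(A - H) \<bullet> (C - H) = - K"
proof -
  define a b c where "a = A - H" and "b = B - H" and "c = C - H"
  define K where "K = - (a \<bullet> b)"
  have tri: "triangle A B C" using acute unfolding acute_triangle_def by blast
  have diff: "A - B = a - b" "B - C = b - c" "C - A = c - a"
    "B - A = b - a" "C - B = c - b" "A - C = a - c" "H - A = - a" "H - B = - b" "H - C = - c"
    unfolding a_def b_def c_def by simp_all
  have "a \<bullet> b = a \<bullet> c" "b \<bullet> c = b \<bullet> a"
    using ort unfolding is_orthocenter_def diff by (simp_all add: inner_diff_right)
  then have ab: "a \<bullet> b = - K" and bc: "b \<bullet> c = - K" and ac: "a \<bullet> c = - K"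
    unfolding K_def by (simp_all add: inner_commute[of b a])
  \<comment> \<open>These are the products spanning the angles at \<open>A\<close>,
    \<open>B\<close>, \<open>C\<close>. Their reciprocals are proportional to the tangents of the
    angles, the barycentric coordinates of the orthocenter, which explains the weights in
    \<open>w\<close>.\<close>
  define p q s where "p = a \<bullet> a + K" and "q = b \<bullet> b + K" and "s = c \<bullet> c + K"
  have pos: "p > 0" "q > 0" "s > 0"
    using acute ab bc ac unfolding acute_triangle_def diff p_def q_def s_def
    by (simp_all add: inner_simps inner_commute)
  \<comment> \<open>\<open>w\<close> has the same inner product with \<open>a\<close>, \<open>b\<close>, \<open>c\<close>, so it vanishes; that determines \<open>K\<close>.\<close>
  define w where "w = (q * s) *\<^sub>R a + (s * p) *\<^sub>R b + (p * q) *\<^sub>R c"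
  have wa: "w \<bullet> a = p * q * s - K * (q * s + s * p + p * q)"
    using ab ac unfolding w_def p_def by (simp add: inner_simps inner_commute algebra_simps)
  have wb: "w \<bullet> b = p * q * s - K * (q * s + s * p + p * q)"
    using ab bc unfolding w_def q_def by (simp add: inner_simps inner_commute algebra_simps)
  have wc: "w \<bullet> c = p * q * s - K * (q * s + s * p + p * q)"
    using bc ac unfolding w_def s_def by (simp add: inner_simps inner_commute algebra_simps)
  have "w = 0"
    by (rule triangle_orthogonal_imp_zero[OF tri])
      (simp_all only: diff inner_diff_right wa wb wc diff_self)
  then have "K * (q * s + s * p + p * q) = p * q * s" using wa by simp
  then have "K * (q * s + s * p + p * q) > 0" using pos by simp
  moreover have "q * s + s * p + p * q > 0" using pos by (simp add: add_pos_pos)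
  ultimately have "K > 0" by (auto simp: zero_less_mult_iff)
  then show thesis using that ab bc ac unfolding a_def b_def c_def by blast
qed

text \<open>Sylvester's relation on the Euler line, with the orthocenter as origin. The difference
  of the two sides is orthogonal to two edges.\<close>

lemma orthocenter_circumcenter:
  assumes tri: "triangle A B C" and ort: "is_orthocenter H A B C" and circ: "is_circumcenter Q A B C"
  shows "2 *\<^sub>R (Q - H) = (A - H) + (B - H) + (C - H)"
proof -
  define a b c q where "a = A - H" and "b = B - H" and "c = C - H" and "q = Q - H"
  have diff: "A - B = a - b" "B - C = b - c" "C - A = c - a" "B - A = b - a"
    "H - A = - a" "H - B = - b" "H - C = - c" "Q - A = q - a" "Q - B = q - b" "Q - C = q - c"
    unfolding a_def b_def c_def q_def by simp_all
  have o: "a \<bullet> (b - c) = 0" "b \<bullet> (c - a) = 0" "c \<bullet> (a - b) = 0"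
    using ort unfolding is_orthocenter_def diff by simp_all
  have "(q - a) \<bullet> (q - a) = (q - b) \<bullet> (q - b)" "(q - b) \<bullet> (q - b) = (q - c) \<bullet> (q - c)"
    using circ unfolding is_circumcenter_def dist_norm diff norm_eq by simp_all
  then have "(2 *\<^sub>R q - a - b - c) \<bullet> (b - a) = 0" "(2 *\<^sub>R q - a - b - c) \<bullet> (c - a) = 0"
    using o by (simp_all add: inner_simps inner_commute)
  then have "2 *\<^sub>R q - a - b - c = 0"
    by (intro triangle_orthogonal_imp_zero[OF tri]) (simp_all only: diff)
  then show ?thesis unfolding a_def b_def c_def q_def by (simp add: algebra_simps)
qed

text \<open>What the reflection argument for one side needs, from Sylvester's relation paired with
  suitable vectors. The last equation says that the power of \<open>H\<close> with respect to the
  circumcircle is \<open>- 2 * K\<close>.\<close>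

lemma macbeath_data:
  assumes acute: "acute_triangle A B C" and ort: "is_orthocenter H A B C"
    and circ: "is_circumcenter Q A B C"
  obtains K where "K > 0" "(A - H) \<bullet> (C - H) = - K" "(B - H) \<bullet> (C - H) = - K"
    "2 * ((C - H) \<bullet> (Q - H)) = (C - H) \<bullet> (C - H) - 2 * K"
    "(Q - A) \<bullet> (Q - A) = (Q - H) \<bullet> (Q - H) + 2 * K"
proof -
  obtain K where K: "K > 0" "(A - H) \<bullet> (B - H) = - K" "(B - H) \<bullet> (C - H) = - K"
    "(A - H) \<bullet> (C - H) = - K"
    using acute_orthocenter_inner[OF acute ort] .
  have tri: "triangle A B C" using acute unfolding acute_triangle_def by blast
  have q: "2 * (v \<bullet> (Q - H)) = v \<bullet> (A - H) + v \<bullet> (B - H) + v \<bullet> (C - H)" for v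
    using arg_cong[OF orthocenter_circumcenter[OF tri ort circ], of "(\<bullet>) v"]
    by (simp only: inner_scaleR_right inner_add_right)
  have QA: "(Q - A) \<bullet> (Q - A)
      = (Q - H) \<bullet> (Q - H) - 2 * ((A - H) \<bullet> (Q - H)) + (A - H) \<bullet> (A - H)"
    by (simp add: inner_simps inner_commute)
  show thesis
  proof (rule that[OF K(1,4,3)])
    show "2 * ((C - H) \<bullet> (Q - H)) = (C - H) \<bullet> (C - H) - 2 * K"
      unfolding q inner_commute[of "C - H" "A - H"] inner_commute[of "C - H" "B - H"] K(2-4)
      by simp
    show "(Q - A) \<bullet> (Q - A) = (Q - H) \<bullet> (Q - H) + 2 * K"
      unfolding QA q using K by simp
  qed
qed

text \<open>The power of \<open>H\<close> is negative. This supplies the strict inequality that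
  \<open>ellipse_foci\<close> demands.\<close>

lemma orthocenter_inside_circumcircle:
  assumes "acute_triangle A B C" "is_orthocenter H A B C" "is_circumcenter Q A B C"
  shows "dist H Q < dist Q A"
proof -
  obtain K where K: "K > 0" "(Q - A) \<bullet> (Q - A) = (Q - H) \<bullet> (Q - H) + 2 * K"
    using macbeath_data[OF assms] .
  then have "norm (Q - H) < norm (Q - A)" unfolding norm_lt by simp
  then show ?thesis by (simp add: dist_norm norm_minus_commute)
qed

text \<open>
  The reflection \<open>M\<close> of the orthocenter in a side lies on the circumcircle, so on that side the sum
  of the distances to the foci is minimal where the segment \<open>MQ\<close> crosses it, with minimum the
  circumradius. The crossing point lies in the circumscribed disc, hence within the side.
\<close>

lemma macbeath_touches_side:
  assumes acute: "acute_triangle A B C" and ort: "is_orthocenter H A B C"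
    and circ: "is_circumcenter Q A B C"
  shows "\<exists>T \<in> closed_segment A B. \<forall>X \<in> affine hull {A, B}.
    dist Q A \<le> dist X H + dist X Q \<and> (dist X H + dist X Q = dist Q A \<longleftrightarrow> X = T)"
proof -
  obtain K where K: "K > 0" "(A - H) \<bullet> (C - H) = - K" "(B - H) \<bullet> (C - H) = - K"
    "2 * ((C - H) \<bullet> (Q - H)) = (C - H) \<bullet> (C - H) - 2 * K"
    "(Q - A) \<bullet> (Q - A) = (Q - H) \<bullet> (Q - H) + 2 * K"
    using macbeath_data[OF acute ort circ] .
  have tri: "triangle A B C" using acute unfolding acute_triangle_def by blast
  note ne = triangle_distinct[OF tri]
  define c where "c = C - H"
  define q where "q = Q - H"
  define G where "G = c \<bullet> c"
  have "c \<noteq> 0" using K(1,2) unfolding c_def by auto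
  then have G: "G > 0" unfolding G_def by simp
  have cq: "c \<bullet> q = G / 2 - K" using K(4) unfolding c_def[symmetric] q_def[symmetric] G_def by simp
  \<comment> \<open>The line \<open>AB\<close> consists of points \<open>X\<close> with
    \<open>(X - H) \<bullet> c = - K\<close>, so the foot of the perpendicular from \<open>H\<close>
    is \<open>H - (K / G) *\<^sub>R c\<close>; doubling the step gives the reflection.\<close>
  define M where "M = H - (2 * K / G) *\<^sub>R c"
  have MH: "(M - H) \<bullet> c = - 2 * K" unfolding M_def using G by (simp add: G_def)
  have line: "(X - H) \<bullet> c = - K" if X: "X \<in> affine hull {A, B}" for X
  proof -
    obtain u where "X = A + u *\<^sub>R (B - A)" using X unfolding affine_hull_2_alt by blast
    then have "X - H = (1 - u) *\<^sub>R (A - H) + u *\<^sub>R (B - H)" by (simp add: algebra_simps)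
    then have "(X - H) \<bullet> c = (1 - u) * (- K) + u * (- K)"
      using K(2,3) unfolding c_def by (simp only: inner_add_left inner_scaleR_left)
    then show ?thesis by (simp add: algebra_simps)
  qed
  have refl: "dist X M = dist X H" if X: "X \<in> affine hull {A, B}" for X
  proof -
    have "X - M = (X - H) + (2 * K / G) *\<^sub>R c" unfolding M_def by simp
    then have "(X - M) \<bullet> (X - M)
        = (X - H) \<bullet> (X - H) + 2 * (2 * K / G) * ((X - H) \<bullet> c) + (2 * K / G)\<^sup>2 * G"
      unfolding G_def
      by (simp only: inner_add_scaleR_self)
    also have "\<dots> = (X - H) \<bullet> (X - H)"
      unfolding line[OF X] using G by (simp add: power2_eq_square field_simps)
    finally show ?thesis unfolding dist_norm norm_eq .
  qed
  have MQ: "dist M Q = dist Q A"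
  proof -
    have "Q - M = q + (2 * K / G) *\<^sub>R c" unfolding M_def q_def by simp
    then have "(Q - M) \<bullet> (Q - M) = q \<bullet> q + 2 * (2 * K / G) * (c \<bullet> q) + (2 * K / G)\<^sup>2 * G"
      unfolding G_def
      by (simp only: inner_add_scaleR_self inner_commute[of q c])
    also have "\<dots> = q \<bullet> q + 2 * K"
      unfolding cq using G by (simp add: power2_eq_square field_simps)
    also have "\<dots> = (Q - A) \<bullet> (Q - A)" using K(5) unfolding q_def by simp
    finally have "norm (Q - M) = norm (Q - A)" unfolding norm_eq .
    then show ?thesis by (simp add: dist_norm norm_minus_commute)
  qed
  have crossing: "(M + t *\<^sub>R (Q - M) - H) \<bullet> c = - 2 * K + t * (G / 2 + K)" for t
  proof -
    have "M + t *\<^sub>R (Q - M) - H = (1 - t) *\<^sub>R (M - H) + t *\<^sub>R q"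
      unfolding q_def by (simp add: algebra_simps)
    then have "(M + t *\<^sub>R (Q - M) - H) \<bullet> c = (1 - t) * ((M - H) \<bullet> c) + t * (c \<bullet> q)"
      by (simp only: inner_add_left inner_scaleR_left inner_commute[of q c])
    then show ?thesis unfolding MH cq by (simp add: algebra_simps)
  qed
  \<comment> \<open>The solution of \<open>crossing\<close> for the value \<open>- K\<close> that
    the sideline takes.\<close>
  define t where "t = K / (G / 2 + K)"
  define T where "T = M + t *\<^sub>R (Q - M)"
  have t: "0 \<le> t" "t \<le> 1" "t * (G / 2 + K) = K" unfolding t_def using G K(1) by auto
  have T_seg: "T \<in> closed_segment M Q"
    unfolding T_def in_segment using t by (auto intro!: exI[of _ t] simp: algebra_simps)
  have T_line: "(T - H) \<bullet> c = - K" unfolding T_def crossing t by simp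
  have Tc: "(T - A) \<bullet> c = 0" "(B - A) \<bullet> c = 0"
    using T_line K(2,3) unfolding c_def by (simp_all add: inner_diff_left)
  have BA: "B - A \<noteq> 0" using ne by simp
  obtain l where l: "T - A = l *\<^sub>R (B - A)"
    using orthogonal_same_imp_parallel[OF Tc \<open>c \<noteq> 0\<close> BA] by blast
  then have T: "T = A + l *\<^sub>R (B - A)" by (simp add: algebra_simps)
  have "0 \<le> l \<and> l \<le> 1"
  proof -
    have "dist T Q \<le> dist Q A"
      using T_seg MQ by (metis between between_mem_segment le_add_same_cancel2 zero_le_dist)
    then have "norm (Q - T) \<le> norm (Q - A)" by (simp add: dist_norm norm_minus_commute)
    then have "(Q - T) \<bullet> (Q - T) \<le> (Q - A) \<bullet> (Q - A)" unfolding norm_le .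
    moreover have "(Q - T) \<bullet> (Q - T)
        = (Q - A) \<bullet> (Q - A) - 2 * l * ((Q - A) \<bullet> (B - A)) + l * l * ((B - A) \<bullet> (B - A))"
      unfolding T by (simp add: inner_simps inner_commute algebra_simps)
    \<comment> \<open>The circumcenter projects to the midpoint of the side; hence lying in the
      circumscribed disc amounts to \<open>l * l - l \<le> 0\<close>, that is, to lying on the chord
      \<open>AB\<close>.\<close>
    moreover have "2 * ((Q - A) \<bullet> (B - A)) = (B - A) \<bullet> (B - A)"
    proof -
      have "dist Q A = dist Q B" using circ unfolding is_circumcenter_def by blast
      then show ?thesis unfolding dist_eq_iff_inner by (simp add: inner_simps inner_commute)
    qed
    moreover have "(l * l - l) * D \<le> 0" if "N \<le> m" "N = m - 2 * l * p + l * l * D" "2 * p = D"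
      for N m p D :: real
      unfolding that(3)[symmetric] using that by (simp add: algebra_simps)
    ultimately have "(l * l - l) * ((B - A) \<bullet> (B - A)) \<le> 0"
      by blast
    moreover have "(B - A) \<bullet> (B - A) > 0" using BA inner_gt_zero_iff by blast
    ultimately have "l * l - l \<le> 0"
      unfolding mult_le_0_iff by linarith
    then have "l * (l - 1) \<le> 0" by (simp add: algebra_simps)
    then show ?thesis by (auto simp: mult_le_0_iff)
  qed
  then have "T \<in> closed_segment A B"
    unfolding T in_segment by (auto intro!: exI[of _ l] simp: algebra_simps)
  moreover have "dist Q A \<le> dist X H + dist X Q" if X: "X \<in> affine hull {A, B}" for X
    using dist_triangle[of M Q X] refl[OF X] MQ by (simp add: dist_commute)
  moreover have "dist X H + dist X Q = dist Q A \<longleftrightarrow> X = T" if X: "X \<in> affine hull {A, B}" for X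
  proof -
    \<comment> \<open>After reflection this is the equality case of the triangle inequality for
      \<open>M\<close>, \<open>X\<close>, \<open>Q\<close>.\<close>
    have "dist X H + dist X Q = dist Q A \<longleftrightarrow> X \<in> closed_segment M Q"
      unfolding between_mem_segment[symmetric] between refl[OF X, symmetric] MQ
      by (auto simp: dist_commute)
    also have "\<dots> \<longleftrightarrow> X = T"
    proof
      assume "X \<in> closed_segment M Q"
      then obtain u where u: "X = M + u *\<^sub>R (Q - M)"
        unfolding in_segment by (auto simp: algebra_simps)
      then have "u * (G / 2 + K) = t * (G / 2 + K)"
        using line[OF X] crossing[of u] t by simp
      then have "u = t" using G K(1) by simp
      then show "X = T" unfolding u T_def by simp
    qed (use T_seg in simp)
    finally show ?thesis .
  qed
  ultimately show ?thesis by blast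
qed

text \<open>Only one ellipse of a confocal family touches a given line: one with a smaller sum
  misses it, one with a larger sum meets it on both sides of the minimizer \<open>T\<close>.\<close>

lemma confocal_tangent_unique:
  fixes F G T :: point
  assumes T: "T \<in> affine hull {A, B}" "dist T F + dist T G = m"
    and min: "\<And>X. X \<in> affine hull {A, B} \<Longrightarrow> m \<le> dist X F + dist X G"
    and tan: "tangent_at {X. dist X F + dist X G = n} (affine hull {A, B}) p"
  shows "n = m"
proof (rule ccontr)
  assume "n \<noteq> m"
  have p: "p \<in> affine hull {A, B}" "dist p F + dist p G = n"
    using tan unfolding tangent_at_def by auto
  then have "m < n" using min[of p] \<open>n \<noteq> m\<close> by simp
  have "p \<noteq> T" using p T \<open>n \<noteq> m\<close> by auto
  \<comment> \<open>Going from \<open>T\<close> away from \<open>p\<close>, the sum of the distances must attain \<open>n\<close> once more.\<close>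
  define g where "g s = T + s *\<^sub>R (T - p)" for s
  define f where "f s = dist (g s) F + dist (g s) G" for s
  \<comment> \<open>Chosen so that the reverse triangle inequality puts \<open>g s1\<close> at
    distance at least \<open>n\<close> from \<open>F\<close>, which the intermediate value theorem
    needs.\<close>
  define s1 where "s1 = (n + norm (T - F)) / norm (T - p)"
  have "n \<ge> 0" using p(2) by (metis add_nonneg_nonneg zero_le_dist)
  then have "s1 \<ge> 0" unfolding s1_def by simp
  have "n = s1 * norm (T - p) - norm (T - F)"
    unfolding s1_def using \<open>p \<noteq> T\<close> by simp
  also have "\<dots> \<le> norm (s1 *\<^sub>R (T - p) + (T - F))"
    using norm_diff_ineq[of "s1 *\<^sub>R (T - p)" "T - F"] \<open>s1 \<ge> 0\<close> by simp
  also have "\<dots> = dist (g s1) F" unfolding g_def dist_norm by (simp add: algebra_simps)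
  also have "\<dots> \<le> f s1" unfolding f_def by simp
  finally have "n \<le> f s1" .
  moreover have "f 0 \<le> n" using T(2) \<open>m < n\<close> unfolding f_def g_def by simp
  moreover have "continuous_on {0..s1} f"
    unfolding f_def g_def by (intro continuous_intros)
  ultimately obtain s where s: "0 \<le> s" "f s = n" using IVT'[of f 0 n s1] \<open>s1 \<ge> 0\<close> by blast
  have "(1 + s) *\<^sub>R T + (- s) *\<^sub>R p \<in> affine hull {A, B}"
    by (rule mem_affine[OF affine_affine_hull T(1) p(1)]) simp
  then have "g s \<in> affine hull {A, B}" unfolding g_def by (simp add: algebra_simps)
  then have "g s = p" using s tan unfolding f_def tangent_at_def by blast
  then have "(1 + s) *\<^sub>R (T - p) = 0" unfolding g_def by (simp add: algebra_simps)
  then show False using \<open>p \<noteq> T\<close> s(1) by simp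
qed

text \<open>Uniqueness of orthocenter and circumcenter fixes the foci, and tangency to a single side
  fixes the major axis. Conversely, \<open>macbeath_touches_side\<close> applies to each side, the
  circumradius being the same for all.\<close>

lemma is_macbeath_inconic_iff:
  assumes acute: "acute_triangle A B C" and ort: "is_orthocenter H A B C"
    and circ: "is_circumcenter Q A B C"
  shows "is_macbeath_inconic E A B C \<longleftrightarrow> E = {X. dist X H + dist X Q = dist Q A}"
proof
  have tri: "triangle A B C" using acute unfolding acute_triangle_def by blast
  obtain T where T: "T \<in> closed_segment A B"
    "\<And>X. X \<in> affine hull {A, B} \<Longrightarrow> dist Q A \<le> dist X H + dist X Q"
    "\<And>X. X \<in> affine hull {A, B} \<Longrightarrow> dist X H + dist X Q = dist Q A \<longleftrightarrow> X = T"
    using macbeath_touches_side[OF acute ort circ] by blast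
  have T_line: "T \<in> affine hull {A, B}"
    using T(1) convex_hull_subset_affine_hull[of "{A, B}"] by (auto simp: segment_convex_hull)
  assume "is_macbeath_inconic E A B C"
  then obtain H' Q' where "is_orthocenter H' A B C" "is_circumcenter Q' A B C" "ellipse_foci E H' Q'"
    and ins: "inscribed E A B C"
    unfolding is_macbeath_inconic_def by blast
  then have "ellipse_foci E H Q"
    using is_orthocenter_unique[OF tri ort] is_circumcenter_unique[OF tri circ] by blast
  then obtain a where E: "E = {X. dist X H + dist X Q = 2 * a}"
    unfolding ellipse_foci_def by blast
  obtain p where "tangent_at E (affine hull {A, B}) p"
    using ins unfolding inscribed_def tangent_to_side_def by blast
  then have "2 * a = dist Q A"
    unfolding E using confocal_tangent_unique[OF T_line _ T(2)] T(3)[OF T_line] by blast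
  then show "E = {X. dist X H + dist X Q = dist Q A}" unfolding E by simp
next
  assume E: "E = {X. dist X H + dist X Q = dist Q A}"
  \<comment> \<open>Stated for an arbitrary triangle with the same centers and circumradius, to be
    used for the three cyclic rotations.\<close>
  have side: "tangent_to_side E A' B'"
    if tri': "acute_triangle A' B' C'" "is_orthocenter H A' B' C'" "is_circumcenter Q A' B' C'"
      and eq: "dist Q A' = dist Q A" for A' B' C'
  proof -
    obtain T where T: "T \<in> closed_segment A' B'"
      "\<And>X. X \<in> affine hull {A', B'} \<Longrightarrow> dist X H + dist X Q = dist Q A \<longleftrightarrow> X = T"
      using macbeath_touches_side[OF tri', unfolded eq] by blast
    have "T \<in> affine hull {A', B'}"
      using T(1) convex_hull_subset_affine_hull[of "{A', B'}"] by (auto simp: segment_convex_hull)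
    then have "E \<inter> affine hull {A', B'} = {T}" unfolding E using T(2) by auto
    then show ?thesis unfolding tangent_to_side_def tangent_at_def using T(1) by blast
  qed
  have eq: "dist Q B = dist Q A" "dist Q C = dist Q A"
    using circ unfolding is_circumcenter_def by auto
  note acute' = acute_triangle_rotate[OF acute] and ort' = is_orthocenter_rotate[OF ort]
    and circ' = is_circumcenter_rotate[OF circ]
  have "inscribed E A B C"
    unfolding inscribed_def
    using side[OF acute ort circ refl] side[OF acute' ort' circ' eq(1)]
      side[OF acute_triangle_rotate[OF acute'] is_orthocenter_rotate[OF ort']
        is_circumcenter_rotate[OF circ'] eq(2)]
    by blast
  moreover have "ellipse_foci E H Q"
    unfolding ellipse_foci_def E using orthocenter_inside_circumcircle[OF assms]
    by (intro exI[of _ "dist Q A / 2"]) simp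
  ultimately show "is_macbeath_inconic E A B C"
    unfolding is_macbeath_inconic_def using acute ort circ by blast
qed

subsection \<open>Semiaxes of an ellipse\<close>

text \<open>Both sides are equivalent to the focal radii being \<open>a + e * x / a\<close> and
  \<open>a - e * x / a\<close>. Here \<open>e\<close> is half the focal distance, not the
  eccentricity.\<close>

lemma sum_of_focal_distances_iff:
  fixes a e x y :: real
  assumes "0 \<le> e" "e < a"
  shows "sqrt ((x + e)\<^sup>2 + y\<^sup>2) + sqrt ((x - e)\<^sup>2 + y\<^sup>2) = 2 * a
    \<longleftrightarrow> (x / a)\<^sup>2 + (y / sqrt (a\<^sup>2 - e\<^sup>2))\<^sup>2 = 1"
    (is "?S1 + ?S2 = 2 * a \<longleftrightarrow> ?eq")
proof -
  have a: "a > 0" using assms by simp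
  have "e\<^sup>2 < a\<^sup>2" using assms by (simp add: power_strict_mono)
  then have b: "a\<^sup>2 - e\<^sup>2 > 0" by simp
  have eq_iff: "?eq \<longleftrightarrow> (x + e)\<^sup>2 + y\<^sup>2 = (a + e * x / a)\<^sup>2"
  proof -
    have "?eq \<longleftrightarrow> x\<^sup>2 / a\<^sup>2 + y\<^sup>2 / (a\<^sup>2 - e\<^sup>2) = 1"
      using b by (simp add: power_divide)
    also have "\<dots> \<longleftrightarrow> x\<^sup>2 * (a\<^sup>2 - e\<^sup>2) + y\<^sup>2 * a\<^sup>2 = a\<^sup>2 * (a\<^sup>2 - e\<^sup>2)"
    proof -
      have "x\<^sup>2 / u + y\<^sup>2 / v = 1 \<longleftrightarrow> x\<^sup>2 * v + y\<^sup>2 * u = u * v" if "u > 0" "v > 0" for u v :: real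
        using that by (auto simp: field_simps)
      then show ?thesis using a b by simp
    qed
    also have "\<dots> \<longleftrightarrow> ((x + e)\<^sup>2 + y\<^sup>2) * a\<^sup>2 = (a\<^sup>2 + e * x)\<^sup>2"
      by (auto simp: power2_eq_square algebra_simps)
    also have "\<dots> \<longleftrightarrow> (x + e)\<^sup>2 + y\<^sup>2 = (a + e * x / a)\<^sup>2"
    proof -
      have "a + e * x / a = (a\<^sup>2 + e * x) / a" using a by (simp add: field_simps power2_eq_square)
      then show ?thesis using a by (simp add: power_divide field_simps)
    qed
    finally show ?thesis .
  qed
  have S: "?S1\<^sup>2 = (x + e)\<^sup>2 + y\<^sup>2" "?S2\<^sup>2 = (x - e)\<^sup>2 + y\<^sup>2" by simp_all
  have diff: "(x - e)\<^sup>2 + y\<^sup>2 = (x + e)\<^sup>2 + y\<^sup>2 - 4 * e * x"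
    by (simp add: power2_eq_square algebra_simps)
  show ?thesis
  proof
    assume sum: "?S1 + ?S2 = 2 * a"
    have "(?S1 - ?S2) * (2 * a) = ?S1\<^sup>2 - ?S2\<^sup>2"
      unfolding sum[symmetric] by (simp add: power2_eq_square algebra_simps)
    also have "\<dots> = 4 * e * x" using S diff by linarith
    finally have "?S1 - ?S2 = 2 * (e * x / a)" using a by (simp add: field_simps)
    then have "?S1 = a + e * x / a" using sum by linarith
    then have "?S1\<^sup>2 = (a + e * x / a)\<^sup>2" by (simp only:)
    then show ?eq unfolding eq_iff S(1) .
  next
    assume eq: ?eq
    \<comment> \<open>The bound on \<open>x / a\<close> makes both candidate focal radii
      nonnegative, so square roots can be taken.\<close>
    have "(x / a)\<^sup>2 \<le> 1" using eq by (metis le_add_same_cancel1 zero_le_power2)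
    then have xa: "\<bar>x / a\<bar> \<le> 1" by (simp add: abs_square_le_1)
    have "\<bar>e * x / a\<bar> = e * \<bar>x / a\<bar>" using assms by (simp add: abs_mult)
    also have "\<dots> \<le> e" using mult_left_le[OF xa assms(1)] .
    finally have bound: "a + e * x / a \<ge> 0" "a - e * x / a \<ge> 0" using assms by linarith+
    have "(x + e)\<^sup>2 + y\<^sup>2 = (a + e * x / a)\<^sup>2" using eq eq_iff by simp
    moreover from this have "(x - e)\<^sup>2 + y\<^sup>2 = (a - e * x / a)\<^sup>2"
      unfolding diff using a by (simp add: power2_eq_square field_simps)
    ultimately have "?S1 = a + e * x / a" "?S2 = a - e * x / a" using bound by simp_all
    then show "?S1 + ?S2 = 2 * a" by simp
  qed
qed

lemma ellipse_semiaxes_foci: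
  fixes F G :: point
  assumes FG: "dist F G = 2 * e" and "e < a"
  shows "ellipse_semiaxes {X. dist X F + dist X G = 2 * a} a (sqrt (a\<^sup>2 - e\<^sup>2))"
proof -
  have e: "0 \<le> e" using FG by (metis zero_le_dist mult_le_cancel_left_pos mult_zero_right zero_less_numeral)
  define c where "c = midpoint F G"
  \<comment> \<open>Coinciding foci determine no axis direction, and any unit vector serves.\<close>
  obtain u :: point where u: "norm u = 1" "G - F = (2 * e) *\<^sub>R u"
  proof (cases "e = 0")
    case True
    then show thesis using that[of "axis 1 1"] FG by simp
  next
    case False
    then show thesis
      using that[of "(1 / (2 * e)) *\<^sub>R (G - F)"] FG e by (simp add: dist_norm norm_minus_commute)
  qed
  have F: "F = c - e *\<^sub>R u" and G: "G = c + e *\<^sub>R u"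
  proof -
    have "G = F + (2 * e) *\<^sub>R u" using u(2) by (simp add: algebra_simps)
    then show "F = c - e *\<^sub>R u" "G = c + e *\<^sub>R u"
      unfolding c_def midpoint_def by (simp_all add: vec_eq_iff field_simps)
  qed
  define v :: point where "v = vector [- u$2, u$1]"
  have u2: "u$1 * u$1 + u$2 * u$2 = 1"
    using u(1) unfolding norm_eq_sqrt_inner by (simp add: inner_vec_def sum_2)
  have v: "norm v = 1" "u \<bullet> v = 0"
    using u2 unfolding v_def norm_eq_sqrt_inner by (simp_all add: inner_vec_def sum_2 vector_2 algebra_simps)
  have coords: "\<exists>x y. X = c + x *\<^sub>R u + y *\<^sub>R v" for X
  proof (intro exI)
    have "w = (w \<bullet> u) *\<^sub>R u + (w \<bullet> v) *\<^sub>R v" for w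
    proof -
      have "w$1 = w$1 * (u$1 * u$1 + u$2 * u$2)" "w$2 = w$2 * (u$1 * u$1 + u$2 * u$2)"
        unfolding u2 by simp_all
      then show ?thesis
        unfolding v_def by (simp add: vec_eq_iff forall_2 inner_vec_def sum_2 vector_2 algebra_simps)
    qed
    from this[of "X - c"]
    show "X = c + ((X - c) \<bullet> u) *\<^sub>R u + ((X - c) \<bullet> v) *\<^sub>R v" by (simp add: algebra_simps)
  qed
  have nrm: "norm (x *\<^sub>R u + y *\<^sub>R v) = sqrt (x\<^sup>2 + y\<^sup>2)" for x y
  proof -
    have "u \<bullet> u = 1" "v \<bullet> v = 1" using u v by (simp_all add: norm_eq_1)
    then have "(x *\<^sub>R u + y *\<^sub>R v) \<bullet> (x *\<^sub>R u + y *\<^sub>R v) = x\<^sup>2 + y\<^sup>2"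
      using v(2) by (simp add: inner_simps inner_commute power2_eq_square)
    then show ?thesis unfolding norm_eq_sqrt_inner by simp
  qed
  have dist: "dist (c + x *\<^sub>R u + y *\<^sub>R v) F = sqrt ((x + e)\<^sup>2 + y\<^sup>2)"
    "dist (c + x *\<^sub>R u + y *\<^sub>R v) G = sqrt ((x - e)\<^sup>2 + y\<^sup>2)" for x y
    unfolding nrm[symmetric] dist_norm F G by (simp_all add: algebra_simps)
  have "{X. dist X F + dist X G = 2 * a}
      = {c + x *\<^sub>R u + y *\<^sub>R v |x y. (x / a)\<^sup>2 + (y / sqrt (a\<^sup>2 - e\<^sup>2))\<^sup>2 = 1}" (is "?L = ?R")
  proof (intro set_eqI iffI)
    fix X assume X: "X \<in> ?L"
    obtain x y where "X = c + x *\<^sub>R u + y *\<^sub>R v" using coords by blast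
    moreover from this have "(x / a)\<^sup>2 + (y / sqrt (a\<^sup>2 - e\<^sup>2))\<^sup>2 = 1"
      using X sum_of_focal_distances_iff[OF e \<open>e < a\<close>, of x y] by (simp add: dist)
    ultimately show "X \<in> ?R" by blast
  next
    fix X assume "X \<in> ?R"
    then obtain x y where "X = c + x *\<^sub>R u + y *\<^sub>R v" "(x / a)\<^sup>2 + (y / sqrt (a\<^sup>2 - e\<^sup>2))\<^sup>2 = 1"
      by blast
    then show "X \<in> ?L" using sum_of_focal_distances_iff[OF e \<open>e < a\<close>, of x y] by (simp add: dist)
  qed
  moreover have "sqrt (a\<^sup>2 - e\<^sup>2) > 0"
    using e \<open>e < a\<close> by (simp add: power_strict_mono)
  moreover have "sqrt (a\<^sup>2 - e\<^sup>2) \<le> a"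
    using e \<open>e < a\<close> by (intro real_le_lsqrt) auto
  ultimately show ?thesis
    unfolding ellipse_semiaxes_def using u(1) v by blast
qed

text \<open>The coordinate-free content of the definition: central symmetry, and the semiaxes as
  attained extreme distances from the center. Uniqueness of the semiaxes uses nothing else.\<close>

lemma ellipse_semiaxes_center:
  assumes "ellipse_semiaxes E a b"
  obtains c p q where "\<And>X. X \<in> E \<Longrightarrow> 2 *\<^sub>R c - X \<in> E" "\<And>X. X \<in> E \<Longrightarrow> dist X c \<le> a"
    "\<And>X. X \<in> E \<Longrightarrow> b \<le> dist X c" "p \<in> E" "dist p c = a" "q \<in> E" "dist q c = b"
proof -
  obtain c u v where ab: "b \<le> a" "0 < b" and uv: "norm u = 1" "norm v = 1" "u \<bullet> v = 0"
    and E: "E = {c + x *\<^sub>R u + y *\<^sub>R v |x y. (x / a)\<^sup>2 + (y / b)\<^sup>2 = 1}"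
    using assms unfolding ellipse_semiaxes_def by blast
  have nrm: "(dist (c + x *\<^sub>R u + y *\<^sub>R v) c)\<^sup>2 = x\<^sup>2 + y\<^sup>2" for x y
  proof -
    have "u \<bullet> u = 1" "v \<bullet> v = 1" using uv by (simp_all add: norm_eq_1)
    then have "(x *\<^sub>R u + y *\<^sub>R v) \<bullet> (x *\<^sub>R u + y *\<^sub>R v) = x\<^sup>2 + y\<^sup>2"
      using uv(3) by (simp add: inner_simps inner_commute power2_eq_square)
    then show ?thesis unfolding dist_norm power2_norm_eq_inner by (simp add: add.assoc)
  qed
  have bounds: "b\<^sup>2 \<le> (dist X c)\<^sup>2 \<and> (dist X c)\<^sup>2 \<le> a\<^sup>2" if XE: "X \<in> E" for X
  proof -
    obtain x y where X: "X = c + x *\<^sub>R u + y *\<^sub>R v" and xy: "(x / a)\<^sup>2 + (y / b)\<^sup>2 = 1"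
      using XE unfolding E by blast
    \<comment> \<open>A convex combination of the squared semiaxes, by \<open>xy\<close>.\<close>
    have d: "(dist X c)\<^sup>2 = a\<^sup>2 * (x / a)\<^sup>2 + b\<^sup>2 * (y / b)\<^sup>2"
      unfolding X nrm using ab by (simp add: power_divide)
    have ba: "b\<^sup>2 \<le> a\<^sup>2" using ab by (simp add: power_mono)
    have "b\<^sup>2 * (x / a)\<^sup>2 \<le> a\<^sup>2 * (x / a)\<^sup>2" "b\<^sup>2 * (y / b)\<^sup>2 \<le> a\<^sup>2 * (y / b)\<^sup>2"
      by (rule mult_right_mono[OF ba], simp)+
    then have "b\<^sup>2 * ((x / a)\<^sup>2 + (y / b)\<^sup>2) \<le> (dist X c)\<^sup>2" "(dist X c)\<^sup>2 \<le> a\<^sup>2 * ((x / a)\<^sup>2 + (y / b)\<^sup>2)"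
      unfolding d distrib_left by simp_all
    then show ?thesis unfolding xy by simp
  qed
  show thesis
  proof (rule that)
    fix X assume "X \<in> E"
    then obtain x y where X: "X = c + x *\<^sub>R u + y *\<^sub>R v" and xy: "(x / a)\<^sup>2 + (y / b)\<^sup>2 = 1"
      unfolding E by blast
    have "2 *\<^sub>R c - X = c + (- x) *\<^sub>R u + (- y) *\<^sub>R v"
      unfolding X by (simp add: algebra_simps scaleR_2)
    moreover have "(- x / a)\<^sup>2 + (- y / b)\<^sup>2 = 1" using xy by simp
    ultimately show "2 *\<^sub>R c - X \<in> E" unfolding E by blast
  next
    fix X assume "X \<in> E"
    then show "dist X c \<le> a" "b \<le> dist X c"
      using bounds[of X] ab by (auto simp: power2_le_iff_abs_le abs_le_square_iff[symmetric])
  next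
    have "(a / a)\<^sup>2 + (0 / b)\<^sup>2 = 1" "(0 / a)\<^sup>2 + (b / b)\<^sup>2 = 1" using ab by simp_all
    then have "c + a *\<^sub>R u + 0 *\<^sub>R v \<in> E" "c + 0 *\<^sub>R u + b *\<^sub>R v \<in> E"
      unfolding E by blast+
    then show "c + a *\<^sub>R u \<in> E" "c + b *\<^sub>R v \<in> E" by simp_all
    show "dist (c + a *\<^sub>R u) c = a" "dist (c + b *\<^sub>R v) c = b"
      using ab uv by (simp_all add: dist_norm)
  qed
qed

text \<open>Two representations could a priori have different centers. Once these are shown equal,
  the semiaxes are the largest and smallest distance from the common center.\<close>

lemma ellipse_semiaxes_unique:
  assumes "ellipse_semiaxes E a b" "ellipse_semiaxes E a' b'"
  shows "a = a'" "b = b'"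
proof -
  \<comment> \<open>Parallelogram law: the farthest point of \<open>E\<close> from any point other than the center is at
    distance more than \<open>a\<close>.\<close>
  have key: "a\<^sup>2 + (dist c c')\<^sup>2 \<le> a'\<^sup>2"
    if "p \<in> E" "dist p c = a" "2 *\<^sub>R c - p \<in> E" and far: "\<And>X. X \<in> E \<Longrightarrow> dist X c' \<le> a'"
    for a a' :: real and c c' p :: point
  proof -
    have "(dist p c')\<^sup>2 \<le> a'\<^sup>2" "(dist (2 *\<^sub>R c - p) c')\<^sup>2 \<le> a'\<^sup>2"
      using that by (simp_all add: power_mono)
    moreover have "(dist p c')\<^sup>2 + (dist (2 *\<^sub>R c - p) c')\<^sup>2 = 2 * (dist p c)\<^sup>2 + 2 * (dist c c')\<^sup>2"
      unfolding dist_norm power2_norm_eq_inner by (simp add: inner_simps inner_commute)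
    ultimately show ?thesis unfolding \<open>dist p c = a\<close> by linarith
  qed
  obtain c p q where 1: "\<And>X. X \<in> E \<Longrightarrow> 2 *\<^sub>R c - X \<in> E" "\<And>X. X \<in> E \<Longrightarrow> dist X c \<le> a"
    "\<And>X. X \<in> E \<Longrightarrow> b \<le> dist X c" "p \<in> E" "dist p c = a" "q \<in> E" "dist q c = b"
    using ellipse_semiaxes_center[OF assms(1)] by blast
  obtain c' p' q' where 2: "\<And>X. X \<in> E \<Longrightarrow> 2 *\<^sub>R c' - X \<in> E" "\<And>X. X \<in> E \<Longrightarrow> dist X c' \<le> a'"
    "\<And>X. X \<in> E \<Longrightarrow> b' \<le> dist X c'" "p' \<in> E" "dist p' c' = a'" "q' \<in> E" "dist q' c' = b'"
    using ellipse_semiaxes_center[OF assms(2)] by blast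
  have k1: "a\<^sup>2 + (dist c c')\<^sup>2 \<le> a'\<^sup>2" by (rule key[OF 1(4,5) 1(1)[OF 1(4)] 2(2)])
  have k2: "a'\<^sup>2 + (dist c' c)\<^sup>2 \<le> a\<^sup>2" by (rule key[OF 2(4,5) 2(1)[OF 2(4)] 1(2)])
  have "(dist c c')\<^sup>2 \<le> 0" using k1 k2 zero_le_power2[of "dist c' c"] by linarith
  then have "c' = c" by simp
  then show "b = b'" using 1(3)[OF 2(6)] 2(3)[OF 1(6)] 1(7) 2(7) by simp
  show "a = a'" using \<open>c' = c\<close> 1(2)[OF 2(4)] 2(2)[OF 1(4)] 1(5) 2(5) by simp
qed

subsection \<open>The excentral triangle\<close>

text \<open>Each excenter is a negative multiple of the vector from \<open>I\<close> to its vertex,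
  so all claims become identities in \<open>x\<close>, \<open>y\<close>, \<open>z\<close>. The
  circumcenter \<open>2 *\<^sub>R Q - I\<close> is the Bevan point.\<close>

lemma excentral_triangle:
  assumes tl: "tangent_lengths I r A B C x y z"
    and circ: "dist Q A = R" "dist Q B = R" "dist Q C = R" and "R \<ge> 0"
  shows "acute_triangle (excenter A B C) (excenter B C A) (excenter C A B)"
    and "is_orthocenter I (excenter A B C) (excenter B C A) (excenter C A B)"
    and "is_circumcenter (2 *\<^sub>R Q - I) (excenter A B C) (excenter B C A) (excenter C A B)"
    and "dist (2 *\<^sub>R Q - I) (excenter A B C) = 2 * R"
proof -
  have tri: "triangle A B C" and pos: "x > 0" "y > 0" "z > 0"
    using tl unfolding tangent_lengths_def by blast+
  define s where "s = x + y + z"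
  \<comment> \<open>The product of the side lengths; as it is four times circumradius times area,
    \<open>N / s\<close> equals \<open>4 * R * r\<close>.\<close>
  define N where "N = (x + y) * (y + z) * (z + x)"
  define a b c where "a = A - I" and "b = B - I" and "c = C - I"
  define A' B' C' where "A' = excenter A B C" and "B' = excenter B C A" and "C' = excenter C A B"
  have "s > 0" "N > 0" unfolding s_def N_def using pos by simp_all
  have r2: "r\<^sup>2 = x * y * z / s"
    using tl \<open>s > 0\<close> unfolding tangent_lengths_def s_def by (simp add: field_simps)
  \<comment> \<open>Substituting \<open>r2\<close> factors \<open>r\<^sup>2 + x\<^sup>2\<close> as
    \<open>x * (x + y) * (z + x) / s\<close>, and cyclically.\<close>
  have rel: "N / s = (y + z) / x * (r\<^sup>2 + x\<^sup>2)" "N / s = (z + x) / y * (r\<^sup>2 + y\<^sup>2)"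
    "N / s = (x + y) / z * (r\<^sup>2 + z\<^sup>2)"
    unfolding r2 N_def using pos \<open>s > 0\<close>
    by (simp_all add: field_simps power2_eq_square) (simp_all add: s_def algebra_simps)
  note g = tangent_lengths_inner[OF tl, folded a_def b_def c_def]
  have A': "A' - I = - ((y + z) / x) *\<^sub>R a"
  proof -
    have "(x + y + z) / x = 1 + (y + z) / x" using pos by (simp add: field_simps)
    then show ?thesis
      unfolding A'_def excenter_eq[OF tl] a_def by (simp only:) (simp add: algebra_simps)
  qed
  have B': "B' - I = - ((z + x) / y) *\<^sub>R b"
  proof -
    have "(y + z + x) / y = 1 + (z + x) / y" using pos by (simp add: field_simps)
    then show ?thesis
      unfolding B'_def excenter_eq[OF tangent_lengths_rotate[OF tl]] b_def
      by (simp only:) (simp add: algebra_simps)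
  qed
  have C': "C' - I = - ((x + y) / z) *\<^sub>R c"
  proof -
    have "(z + x + y) / z = 1 + (x + y) / z" using pos by (simp add: field_simps)
    then show ?thesis
      unfolding C'_def excenter_eq[OF tangent_lengths_rotate[OF tangent_lengths_rotate[OF tl]]] c_def
      by (simp only:) (simp add: algebra_simps)
  qed
  \<comment> \<open>The vertices seen from \<open>I\<close> have pairwise equal negative inner products, so \<open>I\<close> is the
    orthocenter and all angles are acute.\<close>
  have in_AB: "(A' - I) \<bullet> (B' - I) = - (N / s)"
    unfolding A' B' inner_scaleR_left inner_scaleR_right g r2 N_def using pos \<open>s > 0\<close>
    by (simp add: field_simps) (simp add: s_def algebra_simps)
  have in_BC: "(B' - I) \<bullet> (C' - I) = - (N / s)"
    unfolding B' C' inner_scaleR_left inner_scaleR_right g r2 N_def using pos \<open>s > 0\<close>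
    by (simp add: field_simps) (simp add: s_def algebra_simps)
  have in_AC: "(A' - I) \<bullet> (C' - I) = - (N / s)"
    unfolding A' C' inner_scaleR_left inner_scaleR_right g r2 N_def using pos \<open>s > 0\<close>
    by (simp add: field_simps) (simp add: s_def algebra_simps)
  have angle: "(V - U) \<bullet> (W - U) > 0"
    if "(U - I) \<bullet> (V - I) = - (N / s)" "(V - I) \<bullet> (W - I) = - (N / s)"
      "(U - I) \<bullet> (W - I) = - (N / s)" for U V W :: point
  proof -
    have "(V - U) \<bullet> (W - U) = (V - I) \<bullet> (W - I) - (U - I) \<bullet> (V - I) - (U - I) \<bullet> (W - I) + (U - I) \<bullet> (U - I)"
      by (simp add: inner_simps inner_commute)
    also have "\<dots> = N / s + (U - I) \<bullet> (U - I)" unfolding that by simp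
    also have "\<dots> > 0" using \<open>N > 0\<close> \<open>s > 0\<close> by (simp add: add_pos_nonneg)
    finally show ?thesis .
  qed
  note sym = inner_commute[of "B' - I" "A' - I"] inner_commute[of "C' - I" "A' - I"]
    inner_commute[of "C' - I" "B' - I"]
  show "acute_triangle (excenter A B C) (excenter B C A) (excenter C A B)"
    unfolding A'_def[symmetric] B'_def[symmetric] C'_def[symmetric]
    by (rule acute_triangleI; rule angle) (simp_all only: sym in_AB in_BC in_AC)
  have ortho: "(I - U) \<bullet> (V - W) = 0" if "(U - I) \<bullet> (V - I) = (U - I) \<bullet> (W - I)" for U V W :: point
    using that by (simp add: inner_simps)
  show "is_orthocenter I (excenter A B C) (excenter B C A) (excenter C A B)"
    unfolding A'_def[symmetric] B'_def[symmetric] C'_def[symmetric] is_orthocenter_def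
    by (intro conjI; rule ortho) (simp_all only: sym in_AB in_BC in_AC)
  define q where "q = Q - I"
  have on_circ: "2 * (q \<bullet> v) = v \<bullet> v + q \<bullet> q - R\<^sup>2" if "dist Q P = R" "v = P - I" for P v
  proof -
    have "R\<^sup>2 = (q - v) \<bullet> (q - v)"
      unfolding that(1)[symmetric] dist_norm power2_norm_eq_inner q_def that(2) by simp
    then show ?thesis by (simp add: inner_simps inner_commute)
  qed
  note qa = on_circ[OF circ(1) a_def, unfolded g] and qb = on_circ[OF circ(2) b_def, unfolded g]
    and qc = on_circ[OF circ(3) c_def, unfolded g]
  \<comment> \<open>Euler's formula for the distance of incenter and circumcenter, obtained by
    pairing the barycentric relation of the incenter with \<open>q\<close>.\<close>
  have euler: "q \<bullet> q = R\<^sup>2 - N / (2 * s)"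
  proof -
    have "(y + z) *\<^sub>R a + (z + x) *\<^sub>R b + (x + y) *\<^sub>R c = 0"
      unfolding a_def b_def c_def
      by (rule incenter_weights(1)[OF tri]) (use tl in \<open>auto simp: tangent_lengths_def\<close>)
    from arg_cong[OF this, of "(\<bullet>) q"]
    have "(y + z) * (2 * (q \<bullet> a)) + (z + x) * (2 * (q \<bullet> b)) + (x + y) * (2 * (q \<bullet> c)) = 0"
      by (simp add: inner_add_right algebra_simps)
    then have "2 * s * (R\<^sup>2 - q \<bullet> q) = 2 * (r\<^sup>2 * s)
        + (y + z) * x\<^sup>2 + (z + x) * y\<^sup>2 + (x + y) * z\<^sup>2"
      unfolding qa qb qc s_def by (simp add: algebra_simps)
    also have "r\<^sup>2 * s = x * y * z" unfolding r2 using \<open>s > 0\<close> by simp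
    finally have "2 * s * (R\<^sup>2 - q \<bullet> q) = N"
      unfolding N_def by (simp add: power2_eq_square algebra_simps)
    then show ?thesis using \<open>s > 0\<close> by (simp add: field_simps)
  qed
  \<comment> \<open>Covers the three excenters at once; \<open>vv\<close>, an instance of
    \<open>rel\<close>, cancels all terms except \<open>(2 * R)\<^sup>2\<close>.\<close>
  have bevan: "dist (2 *\<^sub>R Q - I) V = 2 * R"
    if V: "V - I = - k *\<^sub>R v" and qv: "2 * (q \<bullet> v) = v \<bullet> v + q \<bullet> q - R\<^sup>2" and vv: "N / s = k * (v \<bullet> v)"
    for k v V
  proof -
    have "2 *\<^sub>R Q - I - V = 2 *\<^sub>R q + k *\<^sub>R v"
      using V unfolding q_def by (simp add: algebra_simps scaleR_2)
    then have "(dist (2 *\<^sub>R Q - I) V)\<^sup>2 = 4 * (q \<bullet> q) + 2 * k * (2 * (q \<bullet> v)) + k * (k * (v \<bullet> v))"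
      unfolding dist_norm power2_norm_eq_inner by (simp add: inner_simps inner_commute algebra_simps)
    also have "\<dots> = (2 * R)\<^sup>2 - 2 * (N / s) + 2 * (k * (v \<bullet> v)) - k * (N / s) + k * (k * (v \<bullet> v))"
      unfolding qv euler by (simp add: power2_eq_square algebra_simps)
    also have "\<dots> = (2 * R)\<^sup>2" unfolding vv by simp
    finally show ?thesis by (rule power2_eq_imp_eq) (use \<open>R \<ge> 0\<close> in simp_all)
  qed
  have "dist (2 *\<^sub>R Q - I) A' = 2 * R"
    by (rule bevan[OF A' on_circ[OF circ(1) a_def] rel(1)[folded g(1)]])
  moreover have "dist (2 *\<^sub>R Q - I) B' = 2 * R"
    by (rule bevan[OF B' on_circ[OF circ(2) b_def] rel(2)[folded g(2)]])
  moreover have "dist (2 *\<^sub>R Q - I) C' = 2 * R"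
    by (rule bevan[OF C' on_circ[OF circ(3) c_def] rel(3)[folded g(3)]])
  ultimately show "is_circumcenter (2 *\<^sub>R Q - I) (excenter A B C) (excenter B C A) (excenter C A B)"
    and "dist (2 *\<^sub>R Q - I) (excenter A B C) = 2 * R"
    unfolding A'_def B'_def C'_def is_circumcenter_def by simp_all
qed

theorem theorem1:
  fixes R r d :: real and X1 X3 :: "real^2"
  assumes "r > 0" and "R \<ge> 2 * r" and "d = sqrt (R * (R - 2 * r))" and "dist X1 X3 = d"
  shows "\<exists>E. (\<forall>\<mu> \<nu>. ellipse_semiaxes E \<mu> \<nu> \<longleftrightarrow> \<mu> = R \<and> \<nu> = sqrt (R\<^sup>2 - d\<^sup>2)) \<and>
    (\<forall>A B C. poristic X3 R X1 r A B C \<longrightarrow>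
      (let A' = excenter A B C; B' = excenter B C A; C' = excenter C A B in
        (\<forall>I5'. is_macbeath_inconic I5' A' B' C' \<longleftrightarrow> I5' = E) \<and>
        tangent E (affine hull {A', B'}) \<and>
        tangent E (affine hull {B', C'}) \<and>
        tangent E (affine hull {C', A'})))"
proof -
  have "R > 0" using assms(1,2) by simp
  have d2: "d\<^sup>2 = R\<^sup>2 - 2 * R * r"
    using assms(1-3) by (simp add: power2_eq_square algebra_simps)
  have "d < R"
  proof (rule power2_less_imp_less)
    show "d\<^sup>2 < R\<^sup>2" unfolding d2 using \<open>R > 0\<close> \<open>r > 0\<close> by simp
  qed (use \<open>R > 0\<close> in simp)
  define X40 where "X40 = 2 *\<^sub>R X3 - X1"
  \<comment> \<open>Fixed before any triangle is chosen: foci and major axis depend only on the two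
    circles, whence stationarity.\<close>
  define E where "E = {X. dist X X1 + dist X X40 = 2 * R}"
  have "X1 - X40 = 2 *\<^sub>R (X1 - X3)" unfolding X40_def by (simp add: algebra_simps scaleR_2)
  then have "dist X1 X40 = 2 * d" using \<open>dist X1 X3 = d\<close> by (simp add: dist_norm)
  then have semi: "ellipse_semiaxes E R (sqrt (R\<^sup>2 - d\<^sup>2))"
    unfolding E_def using \<open>d < R\<close> by (rule ellipse_semiaxes_foci)
  have "ellipse_semiaxes E \<mu> \<nu> \<longleftrightarrow> \<mu> = R \<and> \<nu> = sqrt (R\<^sup>2 - d\<^sup>2)" for \<mu> \<nu>
    using semi ellipse_semiaxes_unique[OF _ semi] by blast
  moreover have "let A' = excenter A B C; B' = excenter B C A; C' = excenter C A B in
        (\<forall>I5'. is_macbeath_inconic I5' A' B' C' \<longleftrightarrow> I5' = E) \<and>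
        tangent E (affine hull {A', B'}) \<and>
        tangent E (affine hull {B', C'}) \<and>
        tangent E (affine hull {C', A'})" if por: "poristic X3 R X1 r A B C" for A B C
  proof -
    have "triangle A B C" "inscribed (sphere X1 r) A B C"
      using por unfolding poristic_def by blast+
    then obtain x y z where tl: "tangent_lengths X1 r A B C x y z"
      using \<open>r > 0\<close> by (rule inscribed_sphere_tangent_lengths)
    have "dist X3 A = R" "dist X3 B = R" "dist X3 C = R"
      using por unfolding poristic_def by simp_all
    note exc = excentral_triangle[OF tl this less_imp_le[OF \<open>R > 0\<close>]]
    have iff: "is_macbeath_inconic I5' (excenter A B C) (excenter B C A) (excenter C A B)
        \<longleftrightarrow> I5' = E" for I5'
      using is_macbeath_inconic_iff[OF exc(1-3)] unfolding exc(4) E_def X40_def .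
    \<comment> \<open>Taking \<open>I5' = E\<close> in \<open>iff\<close> shows \<open>E\<close>
      itself to be inscribed, which yields the caustic property.\<close>
    then have "inscribed E (excenter A B C) (excenter B C A) (excenter C A B)"
      unfolding is_macbeath_inconic_def by blast
    then show ?thesis
      using iff unfolding Let_def inscribed_def tangent_to_side_def tangent_def by blast
  qed
  ultimately show ?thesis by blast
qed

end
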